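(* Let $n\ge 0$. Every model structure on the category $[n]$ can be obtained from the trivial model structure on $[n]$ by a finite sequence of left and right Bousfield localizations of the form $L_i$ and $R_i$ with $0\le i<n$.
   Context: $[n]$ denotes the poset $\{0<1<\dots<n\}$ regarded as a category (a unique morphism $i\to j$ iff $i\le j$). A weak factorization system on a category is a pair $(\mathcal L,\mathcal R)$ of classes of morphisms such that every morphism factors as $pi$ with $i\in\mathcal L$, $p\in\mathcal R$; every $i\in\mathcal L$ has the left lifting property with respect to every $p\in\mathcal R$; and both classes are closed under retracts. A model structure is a triple $(\mathsf W,\mathsf C,\mathsf F)$ of classes of morphisms such that $\mathsf W$ satisfies 2-out-of-3 and $(\mathsf C,\mathsf W\cap\mathsf F)$ and $(\mathsf W\cap\mathsf C,\mathsf F)$ are weak factorization systems. The trivial model structure is the one in which only isomorphisms are weak equivalences and all maps are both fibrations and cofibrations. Bousfield localization: let $\mathcal C$ be a model category with homotopy mapping spaces $\mathrm{Map}(X,Y)$ (simplicial sets, well defined up to weak equivalence, with $\pi_0\mathrm{Map}(X,Y)=\mathrm{Hom}_{\mathrm{Ho}(\mathcal C)}(X,Y)$), and let $\mathcal W$ be a set of morphisms. A fibrant object $Z$ is $\mathcal W$-local if $f^*\colon\mathrm{Map}(Y,Z)\to\mathrm{Map}(X,Z)$ is a weak equivalence for all $f\colon X\to Y$ in $\mathcal W$; a morphism $g\colon A\to B$ is a $\mathcal W$-equivalence if $g^*\colon\mathrm{Map}(B,Z)\to\mathrm{Map}(A,Z)$ is a weak equivalence for all $\mathcal W$-local $Z$.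 Dually, a cofibrant object $Z$ is $\mathcal W$-colocal if $f_*\colon\mathrm{Map}(Z,X)\to\mathrm{Map}(Z,Y)$ is a weak equivalence for all $f\in\mathcal W$, and $g\colon A\to B$ is a $\mathcal W$-coequivalence if $g_*\colon\mathrm{Map}(Z,A)\to\mathrm{Map}(Z,B)$ is a weak equivalence for all $\mathcal W$-colocal $Z$. The left Bousfield localization $L_{\mathcal W}\mathcal C$ is the model structure with the same cofibrations as $\mathcal C$ and with weak equivalences the $\mathcal W$-equivalences; the right Bousfield localization $R_{\mathcal W}\mathcal C$ is the model structure with the same fibrations as $\mathcal C$ and with weak equivalences the $\mathcal W$-coequivalences. (Both exist for every model structure on $[n]$.) For a model structure on $[n]$ and $0\le i<n$, write $L_i=L_{\{i\to i+1\}}$ and $R_i=R_{\{i\to i+1\}}$. *)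

theory Defs
  imports "HOL-Analysis.Analysis" "HOL-Homology.Simplices"
begin

section \<open>Categories\<close>

record ('o, 'a) cat =
  Obj :: "'o set"
  Arr :: "'a set"
  Dom :: "'a \<Rightarrow> 'o"
  Cod :: "'a \<Rightarrow> 'o"
  Id :: "'o \<Rightarrow> 'a"
  Comp :: "'a \<Rightarrow> 'a \<Rightarrow> 'a"

text \<open>\<open>Comp C g f\<close> is \<open>g\<close> after \<open>f\<close>.\<close>

definition arrows :: "('o, 'a) cat \<Rightarrow> 'o \<Rightarrow> 'o \<Rightarrow> 'a set" where
  "arrows C x y = {f \<in> Arr C. Dom C f = x \<and> Cod C f = y}"

definition category :: "('o, 'a) cat \<Rightarrow> bool" where
  "category C \<longleftrightarrow>
     (\<forall>f\<in>Arr C. Dom C f \<in> Obj C \<and> Cod C f \<in> Obj C) \<and>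
     (\<forall>x\<in>Obj C. Id C x \<in> arrows C x x) \<and>
     (\<forall>f\<in>Arr C. \<forall>g\<in>Arr C. Cod C f = Dom C g \<longrightarrow> Comp C g f \<in> arrows C (Dom C f) (Cod C g)) \<and>
     (\<forall>f\<in>Arr C. Comp C f (Id C (Dom C f)) = f \<and> Comp C (Id C (Cod C f)) f = f) \<and>
     (\<forall>f\<in>Arr C. \<forall>g\<in>Arr C. \<forall>h\<in>Arr C. Cod C f = Dom C g \<longrightarrow> Cod C g = Dom C h \<longrightarrow>
        Comp C h (Comp C g f) = Comp C (Comp C h g) f)"

definition op_cat :: "('o, 'a) cat \<Rightarrow> ('o, 'a) cat" where
  "op_cat C = C\<lparr>Dom := Cod C, Cod := Dom C, Comp := (\<lambda>g f. Comp C f g)\<rparr>"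

definition ordinal_cat :: "nat \<Rightarrow> (nat, nat \<times> nat) cat" where
  "ordinal_cat n = \<lparr>Obj = {0..n}, Arr = {(i, j). i \<le> j \<and> j \<le> n}, Dom = fst, Cod = snd,
     Id = (\<lambda>i. (i, i)), Comp = (\<lambda>g f. (fst f, snd g))\<rparr>"

lemma category_ordinal_cat: "category (ordinal_cat n)"
  by (auto simp: category_def ordinal_cat_def arrows_def)

definition isomorphism :: "('o, 'a) cat \<Rightarrow> 'a \<Rightarrow> bool" where
  "isomorphism C f \<longleftrightarrow> f \<in> Arr C \<and>
     (\<exists>g\<in>arrows C (Cod C f) (Dom C f). Comp C g f = Id C (Dom C f) \<and> Comp C f g = Id C (Cod C f))"

definition initial_obj :: "('o, 'a) cat \<Rightarrow> 'o \<Rightarrow> bool" where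
  "initial_obj C a \<longleftrightarrow> a \<in> Obj C \<and> (\<forall>x\<in>Obj C. \<exists>!f. f \<in> arrows C a x)"

definition terminal_obj :: "('o, 'a) cat \<Rightarrow> 'o \<Rightarrow> bool" where
  "terminal_obj C a \<longleftrightarrow> a \<in> Obj C \<and> (\<forall>x\<in>Obj C. \<exists>!f. f \<in> arrows C x a)"

section \<open>Model structures\<close>

definition has_lifting :: "('o, 'a) cat \<Rightarrow> 'a \<Rightarrow> 'a \<Rightarrow> bool" where
  "has_lifting C i p \<longleftrightarrow>
     (\<forall>u\<in>arrows C (Dom C i) (Dom C p). \<forall>v\<in>arrows C (Cod C i) (Cod C p).
        Comp C p u = Comp C v i \<longrightarrow>
        (\<exists>h\<in>arrows C (Cod C i) (Dom C p). Comp C h i = u \<and> Comp C p h = v))"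

definition retract_of_arrow :: "('o, 'a) cat \<Rightarrow> 'a \<Rightarrow> 'a \<Rightarrow> bool" where
  "retract_of_arrow C f g \<longleftrightarrow>
     (\<exists>s\<in>arrows C (Dom C f) (Dom C g). \<exists>s'\<in>arrows C (Cod C f) (Cod C g).
      \<exists>r\<in>arrows C (Dom C g) (Dom C f). \<exists>r'\<in>arrows C (Cod C g) (Cod C f).
        Comp C r s = Id C (Dom C f) \<and> Comp C r' s' = Id C (Cod C f) \<and>
        Comp C g s = Comp C s' f \<and> Comp C f r = Comp C r' g)"

definition closed_under_retracts :: "('o, 'a) cat \<Rightarrow> 'a set \<Rightarrow> bool" where
  "closed_under_retracts C S \<longleftrightarrow> (\<forall>f\<in>Arr C. \<forall>g\<in>S. retract_of_arrow C f g \<longrightarrow> f \<in> S)"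

definition weak_factorization_system :: "('o, 'a) cat \<Rightarrow> 'a set \<Rightarrow> 'a set \<Rightarrow> bool" where
  "weak_factorization_system C L R \<longleftrightarrow>
     L \<subseteq> Arr C \<and> R \<subseteq> Arr C \<and>
     (\<forall>f\<in>Arr C. \<exists>i\<in>L. \<exists>p\<in>R. Cod C i = Dom C p \<and> Comp C p i = f) \<and>
     (\<forall>i\<in>L. \<forall>p\<in>R. has_lifting C i p) \<and>
     closed_under_retracts C L \<and> closed_under_retracts C R"

definition two_out_of_three :: "('o, 'a) cat \<Rightarrow> 'a set \<Rightarrow> bool" where
  "two_out_of_three C W \<longleftrightarrow>
     (\<forall>f\<in>Arr C. \<forall>g\<in>Arr C. Cod C f = Dom C g \<longrightarrow>
        (f \<in> W \<and> g \<in> W \<longrightarrow> Comp C g f \<in> W) \<and>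
        (f \<in> W \<and> Comp C g f \<in> W \<longrightarrow> g \<in> W) \<and>
        (g \<in> W \<and> Comp C g f \<in> W \<longrightarrow> f \<in> W))"

record 'a model_str =
  Weq :: "'a set"
  Cof :: "'a set"
  Fib :: "'a set"

definition model_structure :: "('o, 'a) cat \<Rightarrow> 'a model_str \<Rightarrow> bool" where
  "model_structure C M \<longleftrightarrow>
     Weq M \<subseteq> Arr C \<and> two_out_of_three C (Weq M) \<and>
     weak_factorization_system C (Cof M) (Weq M \<inter> Fib M) \<and>
     weak_factorization_system C (Weq M \<inter> Cof M) (Fib M)"

definition op_model :: "'a model_str \<Rightarrow> 'a model_str" where
  "op_model M = \<lparr>Weq = Weq M, Cof = Fib M, Fib = Cof M\<rparr>"

definition trivial_model :: "('o, 'a) cat \<Rightarrow> 'a model_str" where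
  "trivial_model C = \<lparr>Weq = {f. isomorphism C f}, Cof = Arr C, Fib = Arr C\<rparr>"

definition fibrant :: "('o, 'a) cat \<Rightarrow> 'a model_str \<Rightarrow> 'o \<Rightarrow> bool" where
  "fibrant C M z \<longleftrightarrow> z \<in> Obj C \<and> (\<exists>t. terminal_obj C t \<and> (\<exists>f\<in>Fib M. f \<in> arrows C z t))"

definition cofibrant :: "('o, 'a) cat \<Rightarrow> 'a model_str \<Rightarrow> 'o \<Rightarrow> bool" where
  "cofibrant C M z \<longleftrightarrow> z \<in> Obj C \<and> (\<exists>a. initial_obj C a \<and> (\<exists>f\<in>Cof M. f \<in> arrows C a z))"

section \<open>Simplicial sets and their weak equivalences\<close>

text \<open>The morphisms \<open>[k] \<rightarrow> [m]\<close> of the simplex category; they compose by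
  \<open>compose {..j}\<close>, and \<open>\<lambda>i\<in>{..m}. i\<close> is the identity on \<open>[m]\<close>.\<close>

definition delta :: "nat \<Rightarrow> nat \<Rightarrow> (nat \<Rightarrow> nat) set" where
  "delta k m = {\<theta> \<in> {..k} \<rightarrow>\<^sub>E {..m}. mono_on {..k} \<theta>}"

text \<open>For \<open>\<theta> : [k] \<rightarrow> [m]\<close>, \<open>sset_act S k m \<theta>\<close> sends \<open>m\<close>-simplices to \<open>k\<close>-simplices.\<close>

record 's sset =
  simplices :: "nat \<Rightarrow> 's set"
  sset_act :: "nat \<Rightarrow> nat \<Rightarrow> (nat \<Rightarrow> nat) \<Rightarrow> 's \<Rightarrow> 's"

definition push_simplex :: "nat \<Rightarrow> (nat \<Rightarrow> nat) \<Rightarrow> (nat \<Rightarrow> real) \<Rightarrow> (nat \<Rightarrow> real)" where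
  "push_simplex k \<theta> t = (\<lambda>j. \<Sum>i\<in>{i. i \<le> k \<and> \<theta> i = j}. t i)"

type_synonym 's cell_point = "(nat \<times> 's) \<times> (nat \<Rightarrow> real)"

definition cells_top :: "'s sset \<Rightarrow> 's cell_point topology" where
  "cells_top S =
     sum_topology (\<lambda>(m, x). subtopology (powertop_real UNIV) (standard_simplex m))
       {(m, x). x \<in> simplices S m}"

definition gluing :: "'s sset \<Rightarrow> ('s cell_point \<times> 's cell_point) set" where
  "gluing S = {(((k, sset_act S k m \<theta> x), t), ((m, x), push_simplex k \<theta> t)) | k m \<theta> x t.
     \<theta> \<in> delta k m \<and> x \<in> simplices S m \<and> t \<in> standard_simplex k}"

definition glue_eq :: "'s sset \<Rightarrow> ('s cell_point \<times> 's cell_point) set" where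
  "glue_eq S = (gluing S \<union> (gluing S)\<inverse>)\<^sup>*"

definition quotient_top :: "'b topology \<Rightarrow> ('b \<times> 'b) set \<Rightarrow> 'b set topology" where
  "quotient_top X E = topology (\<lambda>U. U \<subseteq> topspace X // E \<and> openin X (\<Union>U))"

lemma openin_quotient_top:
  assumes "equiv UNIV E"
  shows "openin (quotient_top X E) U \<longleftrightarrow> U \<subseteq> topspace X // E \<and> openin X (\<Union>U)"
proof -
  have disj: "\<Union>(S \<inter> T) = \<Union>S \<inter> \<Union>T"
    if "S \<subseteq> topspace X // E" "T \<subseteq> topspace X // E" for S T
  proof -
    have "A = B" if "A \<in> S" "B \<in> T" "x \<in> A" "x \<in> B" for A B x
    proof -
      have "A \<in> UNIV // E" "B \<in> UNIV // E"
        using that \<open>S \<subseteq> _\<close> \<open>T \<subseteq> _\<close> by (auto simp: quotient_def)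
      then show ?thesis
        using quotient_disj[OF assms] that by blast
    qed
    then show ?thesis by blast
  qed
  have "istopology (\<lambda>U. U \<subseteq> topspace X // E \<and> openin X (\<Union>U))"
    unfolding istopology_def
  proof (intro conjI allI impI)
    fix K
    assume K: "\<forall>A\<in>K. A \<subseteq> topspace X // E \<and> openin X (\<Union>A)"
    then show "\<Union>K \<subseteq> topspace X // E" by blast
    have "\<Union>(\<Union>K) = \<Union>(Union ` K)" by blast
    then show "openin X (\<Union>(\<Union>K))"
      using K by (metis (no_types, lifting) imageE openin_Union)
  qed (use disj in auto)
  then show ?thesis
    by (simp add: quotient_top_def)
qed

lemma equiv_glue_eq: "equiv UNIV (glue_eq S)"
  unfolding glue_eq_def
  by (intro equivI) (auto simp: refl_rtrancl trans_rtrancl intro: sym_rtrancl sym_Un_converse)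

definition realization :: "'s sset \<Rightarrow> 's cell_point set topology" where
  "realization S = quotient_top (cells_top S) (glue_eq S)"

text \<open>The union below is over equal classes when \<open>f\<close> commutes with the simplicial operators.\<close>

definition realization_map ::
    "'t sset \<Rightarrow> (nat \<Rightarrow> 's \<Rightarrow> 't) \<Rightarrow> 's cell_point set \<Rightarrow> 't cell_point set" where
  "realization_map T f c = (\<Union>((m, x), t)\<in>c. glue_eq T `` {((m, f m x), t)})"

definition homotopy_equivalence :: "'b topology \<Rightarrow> 'c topology \<Rightarrow> ('b \<Rightarrow> 'c) \<Rightarrow> bool" where
  "homotopy_equivalence X Y f \<longleftrightarrow> continuous_map X Y f \<and>
     (\<exists>g. continuous_map Y X g \<and>
          homotopic_with (\<lambda>x. True) X X (g \<circ> f) id \<and>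
          homotopic_with (\<lambda>x. True) Y Y (f \<circ> g) id)"

text \<open>Realizations are CW complexes, so by Whitehead's theorem homotopy equivalences and weak
  homotopy equivalences between them coincide.\<close>

definition sset_weak_equiv :: "'s sset \<Rightarrow> 't sset \<Rightarrow> (nat \<Rightarrow> 's \<Rightarrow> 't) \<Rightarrow> bool" where
  "sset_weak_equiv S T f \<longleftrightarrow>
     homotopy_equivalence (realization S) (realization T) (realization_map T f)"

section \<open>Homotopy mapping spaces\<close>

record ('o, 'a) cosimp =
  cobj :: "nat \<Rightarrow> 'o"
  cmap :: "nat \<Rightarrow> nat \<Rightarrow> (nat \<Rightarrow> nat) \<Rightarrow> 'a"

definition cosimplicial_object :: "('o, 'a) cat \<Rightarrow> ('o, 'a) cosimp \<Rightarrow> bool" where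
  "cosimplicial_object C X \<longleftrightarrow>
     (\<forall>m. cobj X m \<in> Obj C) \<and>
     (\<forall>k m. \<forall>\<theta>\<in>delta k m. cmap X k m \<theta> \<in> arrows C (cobj X k) (cobj X m)) \<and>
     (\<forall>m. cmap X m m (\<lambda>i\<in>{..m}. i) = Id C (cobj X m)) \<and>
     (\<forall>j k m. \<forall>\<sigma>\<in>delta j k. \<forall>\<theta>\<in>delta k m.
        cmap X j m (compose {..j} \<theta> \<sigma>) = Comp C (cmap X k m \<theta>) (cmap X j k \<sigma>))"

definition cosimplicial_map ::
    "('o, 'a) cat \<Rightarrow> ('o, 'a) cosimp \<Rightarrow> ('o, 'a) cosimp \<Rightarrow> (nat \<Rightarrow> 'a) \<Rightarrow> bool" where
  "cosimplicial_map C X Y \<phi> \<longleftrightarrow>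
     (\<forall>m. \<phi> m \<in> arrows C (cobj X m) (cobj Y m)) \<and>
     (\<forall>k m. \<forall>\<theta>\<in>delta k m. Comp C (\<phi> m) (cmap X k m \<theta>) = Comp C (cmap Y k m \<theta>) (\<phi> k))"

definition delta_inj :: "nat \<Rightarrow> nat \<Rightarrow> (nat \<Rightarrow> nat) set" where
  "delta_inj k m = {\<theta> \<in> delta k m. inj_on \<theta> {..k}}"

text \<open>The latching object of \<open>X\<close> at \<open>m\<close> is the colimit of \<open>X\<close> over the category of non-identity
  injections \<open>[k] \<rightarrow> [m]\<close>. For \<open>m = 0\<close> this is an initial object.\<close>

definition latching_cocone ::
    "('o, 'a) cat \<Rightarrow> ('o, 'a) cosimp \<Rightarrow> nat \<Rightarrow> 'o \<Rightarrow> (nat \<Rightarrow> (nat \<Rightarrow> nat) \<Rightarrow> 'a) \<Rightarrow> bool" where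
  "latching_cocone C X m l c \<longleftrightarrow> l \<in> Obj C \<and>
     (\<forall>k<m. \<forall>\<theta>\<in>delta_inj k m. c k \<theta> \<in> arrows C (cobj X k) l \<and>
        (\<forall>j. \<forall>\<sigma>\<in>delta_inj j k. Comp C (c k \<theta>) (cmap X j k \<sigma>) = c j (compose {..j} \<theta> \<sigma>)))"

definition latching_object ::
    "('o, 'a) cat \<Rightarrow> ('o, 'a) cosimp \<Rightarrow> nat \<Rightarrow> 'o \<Rightarrow> (nat \<Rightarrow> (nat \<Rightarrow> nat) \<Rightarrow> 'a) \<Rightarrow> bool" where
  "latching_object C X m l c \<longleftrightarrow> latching_cocone C X m l c \<and>
     (\<forall>l' c'. latching_cocone C X m l' c' \<longrightarrow>
        (\<exists>!u. u \<in> arrows C l l' \<and> (\<forall>k<m. \<forall>\<theta>\<in>delta_inj k m. Comp C u (c k \<theta>) = c' k \<theta>)))"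

definition reedy_cofibrant ::
    "('o, 'a) cat \<Rightarrow> 'a model_str \<Rightarrow> ('o, 'a) cosimp \<Rightarrow> bool" where
  "reedy_cofibrant C M X \<longleftrightarrow>
     (\<forall>m. \<exists>l c. latching_object C X m l c \<and>
        (\<exists>i\<in>Cof M. i \<in> arrows C l (cobj X m) \<and>
           (\<forall>k<m. \<forall>\<theta>\<in>delta_inj k m. Comp C i (c k \<theta>) = cmap X k m \<theta>)))"

text \<open>A cosimplicial resolution of \<open>x\<close>: a Reedy cofibrant cosimplicial object with a levelwise
  weak equivalence \<open>e\<close> to the constant one at \<open>x\<close>. A simplicial resolution of \<open>x\<close> is a
  cosimplicial resolution in the opposite model category.\<close>

definition cosimplicial_resolution ::
    "('o, 'a) cat \<Rightarrow> 'a model_str \<Rightarrow> 'o \<Rightarrow> ('o, 'a) cosimp \<Rightarrow> (nat \<Rightarrow> 'a) \<Rightarrow> bool" where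
  "cosimplicial_resolution C M x X e \<longleftrightarrow>
     cosimplicial_object C X \<and> reedy_cofibrant C M X \<and>
     (\<forall>m. e m \<in> Weq M \<and> e m \<in> arrows C (cobj X m) x) \<and>
     (\<forall>k m. \<forall>\<theta>\<in>delta k m. Comp C (e m) (cmap X k m \<theta>) = e k)"

abbreviation simplicial_resolution ::
    "('o, 'a) cat \<Rightarrow> 'a model_str \<Rightarrow> 'o \<Rightarrow> ('o, 'a) cosimp \<Rightarrow> (nat \<Rightarrow> 'a) \<Rightarrow> bool" where
  "simplicial_resolution C M \<equiv> cosimplicial_resolution (op_cat C) (op_model M)"

text \<open>The two-sided homotopy function complex, for \<open>X\<close> a cosimplicial resolution of \<open>x\<close> and
  \<open>Y\<close> a simplicial resolution of \<open>y\<close>: the diagonal of \<open>C(X\<^sup>p, Y\<^sub>q)\<close>, a model of \<open>Map(x, y)\<close>.\<close>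

definition map_space ::
    "('o, 'a) cat \<Rightarrow> ('o, 'a) cosimp \<Rightarrow> ('o, 'a) cosimp \<Rightarrow> 'a sset" where
  "map_space C X Y = \<lparr>simplices = (\<lambda>m. arrows C (cobj X m) (cobj Y m)),
     sset_act = (\<lambda>k m \<theta> h. Comp C (cmap Y k m \<theta>) (Comp C h (cmap X k m \<theta>)))\<rparr>"

text \<open>\<open>precomp_weak_equiv C M f z\<close>: the map \<open>f\<^sup>* : Map(y, z) \<rightarrow> Map(x, z)\<close> induced by
  \<open>f : x \<rightarrow> y\<close> is a weak equivalence; dually \<open>postcomp_weak_equiv C M f z\<close> for
  \<open>f\<^sub>* : Map(z, x) \<rightarrow> Map(z, y)\<close>. The induced map is computed from a map of
  resolutions over \<open>f\<close>. Resolutions and such maps exist, and whether the result is a weak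
  equivalence does not depend on them.\<close>

definition precomp_weak_equiv :: "('o, 'a) cat \<Rightarrow> 'a model_str \<Rightarrow> 'a \<Rightarrow> 'o \<Rightarrow> bool" where
  "precomp_weak_equiv C M f z \<longleftrightarrow>
     (\<exists>X eX Y eY \<phi> Z eZ.
        cosimplicial_resolution C M (Dom C f) X eX \<and>
        cosimplicial_resolution C M (Cod C f) Y eY \<and>
        cosimplicial_map C X Y \<phi> \<and> (\<forall>m. Comp C (eY m) (\<phi> m) = Comp C f (eX m)) \<and>
        simplicial_resolution C M z Z eZ \<and>
        sset_weak_equiv (map_space C Y Z) (map_space C X Z) (\<lambda>m h. Comp C h (\<phi> m)))"

text \<open>Below, \<open>\<psi>\<close> is a map of simplicial objects from \<open>X\<close> to \<open>Y\<close>, hence a map of cosimplicial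
  objects of the opposite category from \<open>Y\<close> to \<open>X\<close>.\<close>

definition postcomp_weak_equiv :: "('o, 'a) cat \<Rightarrow> 'a model_str \<Rightarrow> 'a \<Rightarrow> 'o \<Rightarrow> bool" where
  "postcomp_weak_equiv C M f z \<longleftrightarrow>
     (\<exists>X eX Y eY \<psi> Z eZ.
        simplicial_resolution C M (Dom C f) X eX \<and>
        simplicial_resolution C M (Cod C f) Y eY \<and>
        cosimplicial_map (op_cat C) Y X \<psi> \<and> (\<forall>m. Comp C (\<psi> m) (eX m) = Comp C (eY m) f) \<and>
        cosimplicial_resolution C M z Z eZ \<and>
        sset_weak_equiv (map_space C Z X) (map_space C Z Y) (\<lambda>m h. Comp C (\<psi> m) h))"

section \<open>Bousfield localizations\<close>

definition local_obj :: "('o, 'a) cat \<Rightarrow> 'a model_str \<Rightarrow> 'a set \<Rightarrow> 'o \<Rightarrow> bool" where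
  "local_obj C M S z \<longleftrightarrow> fibrant C M z \<and> (\<forall>f\<in>S. precomp_weak_equiv C M f z)"

definition local_equivs :: "('o, 'a) cat \<Rightarrow> 'a model_str \<Rightarrow> 'a set \<Rightarrow> 'a set" where
  "local_equivs C M S =
     {g \<in> Arr C. \<forall>z. local_obj C M S z \<longrightarrow> precomp_weak_equiv C M g z}"

definition colocal_obj :: "('o, 'a) cat \<Rightarrow> 'a model_str \<Rightarrow> 'a set \<Rightarrow> 'o \<Rightarrow> bool" where
  "colocal_obj C M S z \<longleftrightarrow> cofibrant C M z \<and> (\<forall>f\<in>S. postcomp_weak_equiv C M f z)"

definition colocal_equivs :: "('o, 'a) cat \<Rightarrow> 'a model_str \<Rightarrow> 'a set \<Rightarrow> 'a set" where
  "colocal_equivs C M S =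
     {g \<in> Arr C. \<forall>z. colocal_obj C M S z \<longrightarrow> postcomp_weak_equiv C M g z}"

text \<open>\<open>M'\<close> is the left (right) Bousfield localization of \<open>M\<close> at \<open>S\<close>. There is at most one such
  \<open>M'\<close>, since a model structure is determined by its weak equivalences together with its
  cofibrations (fibrations).\<close>

definition left_localization ::
    "('o, 'a) cat \<Rightarrow> 'a model_str \<Rightarrow> 'a set \<Rightarrow> 'a model_str \<Rightarrow> bool" where
  "left_localization C M S M' \<longleftrightarrow>
     model_structure C M' \<and> Cof M' = Cof M \<and> Weq M' = local_equivs C M S"

definition right_localization ::
    "('o, 'a) cat \<Rightarrow> 'a model_str \<Rightarrow> 'a set \<Rightarrow> 'a model_str \<Rightarrow> bool" where
  "right_localization C M S M' \<longleftrightarrow>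
     model_structure C M' \<and> Fib M' = Fib M \<and> Weq M' = colocal_equivs C M S"

inductive obtainable :: "nat \<Rightarrow> (nat \<times> nat) model_str \<Rightarrow> bool" for n where
  trivial: "obtainable n (trivial_model (ordinal_cat n))"
| left: "obtainable n M \<Longrightarrow> i < n \<Longrightarrow>
    left_localization (ordinal_cat n) M {(i, i + 1)} M' \<Longrightarrow> obtainable n M'"
| right: "obtainable n M \<Longrightarrow> i < n \<Longrightarrow>
    right_localization (ordinal_cat n) M {(i, i + 1)} M' \<Longrightarrow> obtainable n M'"

end

theory Submission
  imports Defs
begin

text \<open>
  The weak equivalences of a model structure on \<open>[n]\<close> form intervals (blocks), and within a block
  every map factors uniquely as an acyclic cofibration followed by an acyclic fibration. If some
  step \<open>p \<rightarrow> q\<close> of a block is crossed by no acyclic fibration, then deleting from the weak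
  equivalences all maps crossing \<open>p \<rightarrow> q\<close>, while keeping the cofibrations, gives a model structure
  whose left localization at \<open>p \<rightarrow> q\<close> is the given one; dually for acyclic cofibrations and right
  localizations. In a block \<open>[a, b]\<close> with \<open>a < b\<close> one of the two happens: if every step were
  crossed by acyclic fibrations, restricting and composing them would make \<open>a \<rightarrow> b\<close> an acyclic
  fibration, and dually an acyclic cofibration, hence an isomorphism. So one can descend to the
  trivial model structure by induction on the number of weak equivalences.

  The localizations are accessible because mapping spaces are empty or contractible: there are maps
  in both directions between any two levels of a resolution, so in a skeletal thin category every
  resolution is constant, at a cofibrant or fibrant replacement.
\<close>

section \<open>Model structures on finite chains\<close>

text \<open>A weak factorization system on a poset: squares commute by themselves, so a lift is just
  \<open>leq b c\<close>, and a retract of an arrow in a skeletal thin category is that arrow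
  itself.\<close>

definition fact_sys :: "('o \<Rightarrow> 'o \<Rightarrow> bool) \<Rightarrow> ('o \<Rightarrow> 'o \<Rightarrow> bool) \<Rightarrow> ('o \<Rightarrow> 'o \<Rightarrow> bool) \<Rightarrow> bool" where
  "fact_sys leq L R \<longleftrightarrow> L \<le> leq \<and> R \<le> leq \<and>
     (\<forall>x y. leq x y \<longrightarrow> (\<exists>z. L x z \<and> R z y)) \<and>
     (\<forall>a b c d. L a b \<longrightarrow> R c d \<longrightarrow> leq a c \<longrightarrow> leq b d \<longrightarrow> leq b c)"

lemma fact_sys_converse: "fact_sys leq L R \<Longrightarrow> fact_sys leq\<inverse>\<inverse> R\<inverse>\<inverse> L\<inverse>\<inverse>"
  unfolding fact_sys_def le_fun_def le_bool_def conversep_iff by blast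

section \<open>Finite chains and factorization systems on them\<close>

locale finite_chain =
  fixes A :: "'o set" and leq :: "'o \<Rightarrow> 'o \<Rightarrow> bool" (infix \<open>\<sqsubseteq>\<close> 50)
  assumes finite_carrier: "finite A"
    and le_carrier: "x \<sqsubseteq> y \<Longrightarrow> x \<in> A \<and> y \<in> A"
    and le_refl: "x \<in> A \<Longrightarrow> x \<sqsubseteq> x"
    and le_trans: "x \<sqsubseteq> y \<Longrightarrow> y \<sqsubseteq> z \<Longrightarrow> x \<sqsubseteq> z"
    and le_antisym: "x \<sqsubseteq> y \<Longrightarrow> y \<sqsubseteq> x \<Longrightarrow> x = y"
    and le_total: "x \<in> A \<Longrightarrow> y \<in> A \<Longrightarrow> x \<sqsubseteq> y \<or> y \<sqsubseteq> x"
begin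

text \<open>The covering relation of the chain, phrased as a division of all objects into those up
  to \<open>p\<close> and those from \<open>q\<close> on.\<close>

definition step :: "'o \<Rightarrow> 'o \<Rightarrow> bool" where
  "step p q \<longleftrightarrow> p \<sqsubseteq> q \<and> p \<noteq> q \<and> (\<forall>x\<in>A. x \<sqsubseteq> p \<or> q \<sqsubseteq> x)"

lemma converse_chain: "finite_chain A leq\<inverse>\<inverse>"
  by unfold_locales
    (use finite_carrier le_carrier le_refl le_antisym le_total in \<open>auto intro: le_trans\<close>)

lemma ex_least:
  assumes "S \<subseteq> A" "S \<noteq> {}"
  shows "\<exists>b\<in>S. \<forall>x\<in>S. b \<sqsubseteq> x"
proof -
  have "finite S" using assms(1) finite_carrier by (rule finite_subset)
  then show ?thesis using assms(2,1)
  proof (induction S rule: finite_ne_induct)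
    case (singleton x)
    then show ?case using le_refl by auto
  next
    case (insert x S)
    then obtain b where "b \<in> S" "\<forall>y\<in>S. b \<sqsubseteq> y" by auto
    then show ?case
      using insert.prems le_total[of x b] le_refl[of x] le_trans[of x b] by auto
  qed
qed

lemma ex_greatest:
  assumes "S \<subseteq> A" "S \<noteq> {}"
  shows "\<exists>b\<in>S. \<forall>x\<in>S. x \<sqsubseteq> b"
  using finite_chain.ex_least[OF converse_chain assms] by simp

lemma ex_step_below:
  assumes "a \<sqsubseteq> y" "a \<noteq> y"
  shows "\<exists>p. step p y \<and> a \<sqsubseteq> p"
proof -
  have "{x. x \<sqsubseteq> y \<and> x \<noteq> y} \<subseteq> A" "{x. x \<sqsubseteq> y \<and> x \<noteq> y} \<noteq> {}"
    using assms le_carrier by auto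
  from ex_greatest[OF this] obtain p
    where "p \<sqsubseteq> y" "p \<noteq> y" "\<And>x. x \<sqsubseteq> y \<Longrightarrow> x \<noteq> y \<Longrightarrow> x \<sqsubseteq> p" by auto
  then show ?thesis
    using assms le_carrier[of a y] le_total le_refl unfolding step_def by metis
qed

lemma step_converse: "finite_chain.step A leq\<inverse>\<inverse> p q \<longleftrightarrow> step q p"
  unfolding finite_chain.step_def[OF converse_chain] step_def by auto

context
  fixes L R
  assumes sys: "fact_sys leq L R"
begin

lemma left_le: "L x y \<Longrightarrow> x \<sqsubseteq> y" and right_le: "R x y \<Longrightarrow> x \<sqsubseteq> y"
  using sys unfolding fact_sys_def by blast+

lemma factor: "x \<sqsubseteq> y \<Longrightarrow> \<exists>z. L x z \<and> R z y"
  using sys unfolding fact_sys_def by blast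

lemma lift: "L a b \<Longrightarrow> R c d \<Longrightarrow> a \<sqsubseteq> c \<Longrightarrow> b \<sqsubseteq> d \<Longrightarrow> b \<sqsubseteq> c"
  using sys unfolding fact_sys_def by blast

lemma left_right_refl: "x \<in> A \<Longrightarrow> L x x \<and> R x x"
  using factor[OF le_refl] left_le right_le le_antisym by metis

text \<open>The retract argument: factor \<open>c -> d\<close> through \<open>z\<close>; the lifting
  condition for \<open>c -> z\<close> gives \<open>z \<sqsubseteq> c\<close>, so
  \<open>z = c\<close> and \<open>c -> d\<close> is the right factor.\<close>

lemma right_iff: "R c d \<longleftrightarrow> c \<sqsubseteq> d \<and> (\<forall>a b. L a b \<longrightarrow> a \<sqsubseteq> c \<longrightarrow> b \<sqsubseteq> d \<longrightarrow> b \<sqsubseteq> c)"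
proof
  assume r: "c \<sqsubseteq> d \<and> (\<forall>a b. L a b \<longrightarrow> a \<sqsubseteq> c \<longrightarrow> b \<sqsubseteq> d \<longrightarrow> b \<sqsubseteq> c)"
  then obtain z where z: "L c z" "R z d" using factor by blast
  then have "z \<sqsubseteq> c" using r le_refl le_carrier right_le by blast
  then show "R c d" using z left_le le_antisym by blast
qed (use lift right_le in blast)

lemma right_trans: "R x y \<Longrightarrow> R y z \<Longrightarrow> R x z"
  unfolding right_iff using le_trans by (metis (full_types))

text \<open>In a chain \<open>c -> k\<close> is the pullback of \<open>c -> d\<close> along
  \<open>k -> d\<close>, and right classes are stable under pullback.\<close>

lemma right_restrict: "R c d \<Longrightarrow> c \<sqsubseteq> k \<Longrightarrow> k \<sqsubseteq> d \<Longrightarrow> R c k"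
  unfolding right_iff using le_trans by blast

end

text \<open>Dually, left classes are stable under pushout; this is read off in the reversed
  order.\<close>

lemma left_extend: "fact_sys leq L R \<Longrightarrow> L c d \<Longrightarrow> c \<sqsubseteq> k \<Longrightarrow> k \<sqsubseteq> d \<Longrightarrow> L k d"
  using finite_chain.right_restrict[OF converse_chain fact_sys_converse, of L R d c k] by simp

end

section \<open>Model structures on a finite chain, given by relations\<close>

locale chain_model = finite_chain +
  fixes W K F :: "'a \<Rightarrow> 'a \<Rightarrow> bool"
  assumes weq_le: "W x y \<Longrightarrow> x \<sqsubseteq> y"
    and weq_comp: "W x y \<Longrightarrow> W y z \<Longrightarrow> W x z"
    and weq_cancel_left: "W x y \<Longrightarrow> W x z \<Longrightarrow> y \<sqsubseteq> z \<Longrightarrow> W y z"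
    and weq_cancel_right: "W y z \<Longrightarrow> W x z \<Longrightarrow> x \<sqsubseteq> y \<Longrightarrow> W x y"
    and cof_sys: "fact_sys leq K (inf W F)"
    and fib_sys: "fact_sys leq (inf W K) F"
begin

lemma converse_model: "chain_model A leq\<inverse>\<inverse> W\<inverse>\<inverse> F\<inverse>\<inverse> K\<inverse>\<inverse>"
proof -
  interpret d: finite_chain A "leq\<inverse>\<inverse>" by (rule converse_chain)
  show ?thesis
    by unfold_locales
      (use fact_sys_converse[OF fib_sys] fact_sys_converse[OF cof_sys] in
        \<open>auto simp: converse_meet intro: weq_le weq_comp weq_cancel_left weq_cancel_right\<close>)
qed

lemma weq_refl: "x \<in> A \<Longrightarrow> W x x"
  using left_right_refl[OF fib_sys] by auto

text \<open>Factor \<open>x -> z\<close> at \<open>t\<close> into an acyclic cofibration and an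
  acyclic fibration. If \<open>y\<close> lies above \<open>t\<close>, pulling back the second gives
  \<open>W t y\<close>; if it lies below, pushing out the first gives \<open>W y t\<close>.\<close>

lemma weq_convex:
  assumes "W x z" "x \<sqsubseteq> y" "y \<sqsubseteq> z"
  shows "W x y" "W y z"
proof -
  obtain t where t: "K x t" "W t z" "F t z"
    using factor[OF cof_sys weq_le[OF assms(1)]] by auto
  then have xt: "W x t" using assms(1) weq_cancel_right left_le[OF cof_sys] by blast
  show "W x y"
  proof (cases "t \<sqsubseteq> y")
    case True
    then have "W t y" using right_restrict[OF cof_sys, of t z y] t assms(3) by auto
    then show ?thesis using xt weq_comp by blast
  next
    case False
    then have "y \<sqsubseteq> t" using le_total le_carrier assms(3) t(2) weq_le by blast
    then have "W y t" using left_extend[OF fib_sys, of x t y] t xt assms(2) by auto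
    then show ?thesis using xt weq_cancel_right assms(2) by blast
  qed
  then show "W y z" using assms weq_cancel_left by blast
qed

text \<open>The order of the homotopy category: \<open>hle x z\<close> holds iff \<open>Map(x, z)\<close> is nonempty.\<close>

definition hle :: "'a \<Rightarrow> 'a \<Rightarrow> bool" where
  "hle x z \<longleftrightarrow> x \<sqsubseteq> z \<or> W z x"

section \<open>Replacements and maps in the homotopy category\<close>

definition cofib :: "'a \<Rightarrow> bool" where
  "cofib c \<longleftrightarrow> (\<exists>b. (\<forall>x\<in>A. b \<sqsubseteq> x) \<and> K b c)"

definition fib :: "'a \<Rightarrow> bool" where
  "fib d \<longleftrightarrow> (\<exists>t. (\<forall>x\<in>A. x \<sqsubseteq> t) \<and> F d t)"

lemma ex_cofib: "x \<in> A \<Longrightarrow> \<exists>c. cofib c \<and> W c x \<and> F c x"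
  using ex_least[of A] factor[OF cof_sys] unfolding cofib_def by fastforce

lemma ex_fib: "x \<in> A \<Longrightarrow> \<exists>d. fib d \<and> W x d"
  using ex_greatest[of A] factor[OF fib_sys] unfolding fib_def by fastforce

text \<open>Lift the cofibration from the least object to \<open>c\<close> against the acyclic
  fibration \<open>c' -> y\<close>.\<close>

lemma cofib_lift:
  assumes "cofib c" "W c' y" "F c' y" "c \<sqsubseteq> y"
  shows "c \<sqsubseteq> c'"
  using assms lift[OF cof_sys] weq_le le_carrier unfolding cofib_def by blast

lemma fib_lift:
  assumes "fib d" "W d t" "K d t"
  shows "t = d"
  using assms lift[OF fib_sys, of d t d] weq_le le_carrier le_refl le_antisym
  unfolding fib_def by blast

text \<open>Since \<open>d\<close> is fibrant, the acyclic cofibration in a factorization of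
  \<open>d -> c\<close> is an identity. So \<open>d -> c\<close> is an acyclic fibration, and the
  identity of the cofibrant \<open>c\<close> lifts through it.\<close>

lemma weq_cofib_fib_le:
  assumes "cofib c" "fib d" "W d c"
  shows "c = d"
proof -
  obtain t where t: "W d t" "K d t" "F t c"
    using factor[OF fib_sys weq_le[OF assms(3)]] by auto
  then have "t = d" using fib_lift assms(2) by blast
  with t have "c \<sqsubseteq> d" using cofib_lift[of c d c] assms le_refl le_carrier weq_le by blast
  then show ?thesis using assms(3) weq_le le_antisym by blast
qed

text \<open>Hence maps between replacements do not depend on the replacements chosen. If
  \<open>c \<sqsubseteq> d\<close> but not \<open>x \<sqsubseteq> z\<close>, then
  \<open>z \<sqsubseteq> x\<close>, and comparing \<open>d\<close> with \<open>x\<close> lets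
  convexity of \<open>W\<close> yield \<open>W z x\<close>.\<close>

lemma le_replacements_iff_hle:
  assumes c: "cofib c" "W c x" and d: "fib d" "W z d"
  shows "c \<sqsubseteq> d \<longleftrightarrow> hle x z"
proof
  assume cd: "c \<sqsubseteq> d"
  have A: "c \<in> A" "x \<in> A" "d \<in> A" "z \<in> A" using c d weq_le le_carrier by blast+
  show "hle x z"
  proof (cases "x \<sqsubseteq> z")
    case False
    then have zx: "z \<sqsubseteq> x" using le_total A by blast
    show ?thesis
    proof (cases "x \<sqsubseteq> d")
      case True
      then show ?thesis using weq_convex(1)[OF d(2) zx] by (simp add: hle_def)
    next
      case False
      then have "W d x" using weq_convex(2)[OF c(2) cd] le_total A by blast
      then show ?thesis using weq_comp d(2) by (auto simp: hle_def)
    qed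
  qed (simp add: hle_def)
next
  assume h: "hle x z"
  have A: "c \<in> A" "x \<in> A" "d \<in> A" "z \<in> A" using c d weq_le le_carrier by blast+
  show "c \<sqsubseteq> d"
  proof (rule ccontr)
    assume n: "\<not> c \<sqsubseteq> d"
    then have dc: "d \<sqsubseteq> c" using le_total A by blast
    have "\<not> x \<sqsubseteq> z" using n c(2) d(2) weq_le le_trans by blast
    \<comment> \<open>Now \<open>z \<sqsubseteq> d \<sqsubseteq> c \<sqsubseteq> x\<close>, so
      convexity turns \<open>W z x\<close> into \<open>W d c\<close>, which forces
      \<open>c = d\<close>.\<close>
    then have "W z x" using h by (simp add: hle_def)
    then have "W d x" using weq_convex(2) d(2) weq_le dc c(2) le_trans by blast
    then have "W d c" using weq_convex(1) dc c(2) weq_le by blast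
    then show False using weq_cofib_fib_le c d n le_refl A by blast
  qed
qed

text \<open>A cofibrant replacement of \<open>x\<close> is also one of \<open>y\<close>.\<close>

lemma hle_weq_left:
  assumes "W x y" "z \<in> A"
  shows "hle x z \<longleftrightarrow> hle y z"
proof -
  obtain c d where "cofib c" "W c x" "fib d" "W z d"
    using ex_cofib ex_fib assms le_carrier weq_le by meson
  then show ?thesis
    using le_replacements_iff_hle[of c x d z] le_replacements_iff_hle[of c y d z]
      weq_comp[OF _ assms(1)] by blast
qed

section \<open>Deleting the weak equivalences across one step\<close>

definition cut_weq :: "'a \<Rightarrow> 'a \<Rightarrow> 'a \<Rightarrow> 'a \<Rightarrow> bool" where
  "cut_weq p q x y \<longleftrightarrow> W x y \<and> \<not> (x \<sqsubseteq> p \<and> q \<sqsubseteq> y)"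

text \<open>With \<open>K\<close> kept, the fibrations are forced: they are the maps with the right
  lifting property against the acyclic cofibrations that remain.\<close>

definition cut_fib :: "'a \<Rightarrow> 'a \<Rightarrow> 'a \<Rightarrow> 'a \<Rightarrow> bool" where
  "cut_fib p q c d \<longleftrightarrow> c \<sqsubseteq> d \<and>
     (\<forall>a b. cut_weq p q a b \<longrightarrow> K a b \<longrightarrow> a \<sqsubseteq> c \<longrightarrow> b \<sqsubseteq> d \<longrightarrow> b \<sqsubseteq> c)"

text \<open>Deleting weak equivalences while keeping \<open>K\<close> can only enlarge the
  fibrations. By \<open>nocross\<close> the acyclic fibrations survive unchanged, so one
  factorization system is inherited and only the other must be built.\<close>

lemma cut_model:
  assumes pq: "step p q" and nocross: "\<And>a b. W a b \<Longrightarrow> F a b \<Longrightarrow> \<not> (a \<sqsubseteq> p \<and> q \<sqsubseteq> b)"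
  shows "chain_model A leq (cut_weq p q) K (cut_fib p q)"
proof
  have side: "x \<sqsubseteq> p \<or> q \<sqsubseteq> x" if "x \<in> A" for x using pq that by (simp add: step_def)
  have disj: "\<not> (x \<sqsubseteq> p \<and> q \<sqsubseteq> x)" for x
    using pq le_trans le_antisym unfolding step_def by blast
  show "x \<sqsubseteq> y" if "cut_weq p q x y" for x y using that weq_le by (simp add: cut_weq_def)
  show "cut_weq p q x z" if "cut_weq p q x y" "cut_weq p q y z" for x y z
    using that weq_comp side[of y] weq_le le_carrier unfolding cut_weq_def by blast
  show "cut_weq p q y z" if "cut_weq p q x y" "cut_weq p q x z" "y \<sqsubseteq> z" for x y z
    using that weq_cancel_left weq_le le_trans unfolding cut_weq_def by blast
  show "cut_weq p q x y" if "cut_weq p q y z" "cut_weq p q x z" "x \<sqsubseteq> y" for x y z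
    using that weq_cancel_right weq_le le_trans unfolding cut_weq_def by blast
  have fib_cut: "cut_fib p q c d" if "F c d" for c d
    using that lift[OF fib_sys] right_le[OF fib_sys] unfolding cut_fib_def cut_weq_def by auto
  \<comment> \<open>From left to right this is a retract argument: factor \<open>a -> b\<close> by
    \<open>cof_sys\<close> at \<open>t\<close>; then \<open>a -> t\<close> is an acyclic cofibration
    that was not deleted, and lifting against it gives \<open>t = a\<close>.\<close>
  have eq: "inf (cut_weq p q) (cut_fib p q) = inf W F"
  proof (intro ext iffI)
    fix a b
    assume "inf (cut_weq p q) (cut_fib p q) a b"
    then have ab: "W a b" "\<not> (a \<sqsubseteq> p \<and> q \<sqsubseteq> b)" "cut_fib p q a b" by (auto simp: cut_weq_def)
    obtain t where t: "K a t" "W t b" "F t b" using factor[OF cof_sys weq_le[OF ab(1)]] by auto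
    have "cut_weq p q a t"
      using t ab weq_cancel_right[of t b a] left_le[OF cof_sys] weq_le le_trans
      unfolding cut_weq_def by blast
    then have "t \<sqsubseteq> a"
      using ab(3) t weq_le le_refl le_carrier unfolding cut_fib_def by blast
    then show "inf W F a b" using t left_le[OF cof_sys] le_antisym by auto
  next
    fix a b
    assume "inf W F a b"
    then show "inf (cut_weq p q) (cut_fib p q) a b"
      using nocross[of a b] fib_cut by (auto simp: cut_weq_def)
  qed
  show "fact_sys leq K (inf (cut_weq p q) (cut_fib p q))" unfolding eq by (rule cof_sys)
  have "\<exists>z. cut_weq p q a z \<and> K a z \<and> cut_fib p q z b" if ab: "a \<sqsubseteq> b" for a b
  proof -
    obtain t where t: "W a t" "K a t" "F t b" using factor[OF fib_sys ab] by auto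
    show ?thesis
    proof (cases "a \<sqsubseteq> p \<and> q \<sqsubseteq> t")
      case False
      then show ?thesis using t fib_cut unfolding cut_weq_def by blast
    next
      case True
      \<comment> \<open>The old acyclic cofibration \<open>a -> t\<close> crosses the step, so it is
        replaced by one that stops before the step: the cofibrant part of
        \<open>a -> p\<close>.\<close>
      then obtain s where s: "K a s" "W s p" "F s p" using factor[OF cof_sys] by auto
      have "p \<sqsubseteq> t" using True pq le_trans unfolding step_def by blast
      then have "W a p" using weq_convex(1)[OF t(1)] True by blast
      then have "W a s" using s weq_cancel_right left_le[OF cof_sys] by blast
      moreover have "\<not> q \<sqsubseteq> s" using disj s weq_le by blast
      moreover have "cut_fib p q s b"
        unfolding cut_fib_def
      proof (intro conjI allI impI)
        show "s \<sqsubseteq> b"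
          using s(2) \<open>p \<sqsubseteq> t\<close> t(3) weq_le le_trans right_le[OF fib_sys] by blast
        \<comment> \<open>A remaining acyclic cofibration that starts below \<open>s\<close> cannot
          cross the step, so it ends below \<open>p\<close> and lifts against the acyclic fibration
          \<open>s -> p\<close>.\<close>
        fix u v assume uv: "cut_weq p q u v" "K u v" "u \<sqsubseteq> s" "v \<sqsubseteq> b"
        then have "v \<sqsubseteq> p"
          using side[of v] s weq_le le_trans le_carrier unfolding cut_weq_def by blast
        then show "v \<sqsubseteq> s" using lift[OF cof_sys uv(2), of s p] s uv(3) by auto
      qed
      ultimately show ?thesis using s(1) unfolding cut_weq_def by blast
    qed
  qed
  then show "fact_sys leq (inf (cut_weq p q) K) (cut_fib p q)"
    using left_le[OF cof_sys] unfolding fact_sys_def cut_fib_def by auto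
qed

text \<open>The right-hand side describes the equivalences local at \<open>p -> q\<close> in the cut
  structure. A deleted weak equivalence splits into \<open>x -> p\<close>, \<open>p -> q\<close> and
  \<open>q -> y\<close>, the outer two kept. Conversely, \<open>x -> y\<close> is tested on a
  fibrant replacement of \<open>x\<close> or, where that does not suffice, of
  \<open>q\<close>.\<close>

lemma weq_iff_cut_local:
  assumes pq: "step p q" "W p q" and cut: "chain_model A leq (cut_weq p q) K F'"
  shows "W x y \<longleftrightarrow> x \<sqsubseteq> y \<and>
    (\<forall>z. chain_model.fib A leq F' z \<and>
         (chain_model.hle leq (cut_weq p q) p z \<longleftrightarrow> chain_model.hle leq (cut_weq p q) q z) \<longrightarrow>
         (chain_model.hle leq (cut_weq p q) x z \<longleftrightarrow> chain_model.hle leq (cut_weq p q) y z))"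
proof -
  interpret c: chain_model A leq "cut_weq p q" K F' by (rule cut)
  have side: "u \<sqsubseteq> p \<or> q \<sqsubseteq> u" if "u \<in> A" for u using pq that by (simp add: step_def)
  have disj: "\<not> (u \<sqsubseteq> p \<and> q \<sqsubseteq> u)" for u
    using pq le_trans le_antisym unfolding step_def by blast
  have pqA: "p \<in> A" "q \<in> A" using pq weq_le le_carrier by blast+
  have fibA: "z \<in> A" if "c.fib z" for z
    using that right_le[OF c.fib_sys] le_carrier unfolding c.fib_def by blast
  show ?thesis
  proof (rule iffI, intro conjI allI impI)
    assume xy: "W x y"
    then show "x \<sqsubseteq> y" by (rule weq_le)
    fix z assume z: "c.fib z \<and> (c.hle p z \<longleftrightarrow> c.hle q z)"
    show "c.hle x z \<longleftrightarrow> c.hle y z"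
    proof (cases "cut_weq p q x y")
      case True
      then show ?thesis using c.hle_weq_left fibA z by blast
    next
      case False
      then have cross: "x \<sqsubseteq> p" "q \<sqsubseteq> y" using xy by (auto simp: cut_weq_def)
      have "W x p" using weq_convex(1)[OF xy] cross weq_le[OF pq(2)] le_trans by blast
      moreover have "W q y" using weq_convex(2)[OF xy] cross weq_le[OF pq(2)] le_trans by blast
      ultimately have "cut_weq p q x p" "cut_weq p q q y"
        using disj pqA le_refl unfolding cut_weq_def by blast+
      then show ?thesis using c.hle_weq_left[of _ _ z] fibA z by blast
    qed
  next
    assume r: "x \<sqsubseteq> y \<and> (\<forall>z. c.fib z \<and> (c.hle p z \<longleftrightarrow> c.hle q z) \<longrightarrow> (c.hle x z \<longleftrightarrow> c.hle y z))"
    have xyA: "x \<in> A" "y \<in> A" using r le_carrier by blast+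
    obtain z where z: "c.fib z" "cut_weq p q x z" using c.ex_fib xyA by blast
    have xz: "W x z" using z by (simp add: cut_weq_def)
    show "W x y"
    proof (cases "c.hle y z")
      case True
      then consider "y \<sqsubseteq> z" | "cut_weq p q z y" unfolding c.hle_def by blast
      then show ?thesis
        using weq_convex(1)[OF xz] r weq_comp[OF xz] by cases (auto simp: cut_weq_def)
    next
      case False
      moreover have "c.hle x z" using z c.weq_le unfolding c.hle_def by blast
      ultimately have "\<not> (c.hle p z \<longleftrightarrow> c.hle q z)" using r z(1) by blast
      \<comment> \<open>A kept weak equivalence from \<open>z \<sqsubseteq> p\<close> to
        \<open>q\<close> would cross the step, so \<open>hle q z\<close> forces
        \<open>q \<sqsubseteq> z\<close> and then \<open>hle p z\<close>. Locality of
        \<open>z\<close> thus fails in one way only.\<close>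
      moreover have "q \<sqsubseteq> z" if "c.hle q z"
        using that side[of z] fibA[OF z(1)] le_refl[OF pqA(2)]
        unfolding c.hle_def cut_weq_def by blast
      then have "c.hle p z" if "c.hle q z"
        using that weq_le[OF pq(2)] le_trans unfolding c.hle_def by blast
      ultimately have "c.hle p z" "\<not> c.hle q z" by blast+
      then have zq: "z \<sqsubseteq> p" using side[of z] fibA z(1) unfolding c.hle_def by blast
      have "W z p"
        using \<open>c.hle p z\<close> le_antisym[OF zq] weq_refl[OF pqA(1)]
        unfolding c.hle_def cut_weq_def by blast
      then have xq: "W x q" using weq_comp xz pq(2) by blast
      \<comment> \<open>Here \<open>x\<close> is weakly equivalent to \<open>q\<close> in the old
        structure. The replacement \<open>w\<close> lies above both \<open>p\<close> and
        \<open>q\<close>, so it is local and the hypothesis applies to it.\<close>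
      obtain w where w: "c.fib w" "cut_weq p q q w" using c.ex_fib pqA by blast
      have xw: "W x w" using w xq weq_comp by (auto simp: cut_weq_def)
      have "p \<sqsubseteq> w" "q \<sqsubseteq> w" "x \<sqsubseteq> w"
        using w c.weq_le pq(2) weq_le le_trans xw by blast+
      then have "c.hle y w" using r w(1) unfolding c.hle_def by blast
      then consider "y \<sqsubseteq> w" | "cut_weq p q w y" unfolding c.hle_def by blast
      then show ?thesis
        using weq_convex(1)[OF xw] r weq_comp[OF xw] by cases (auto simp: cut_weq_def)
    qed
  qed
qed

text \<open>Take the least \<open>y\<close> violating the claim and its predecessor
  \<open>p\<close>. An acyclic fibration crossing \<open>p -> y\<close> restricts to some
  \<open>c -> y\<close>, where \<open>a \<sqsubseteq> c\<close> because the block starts at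
  \<open>a\<close>. By minimality \<open>a -> c\<close> is a fibration, and composing gives a
  contradiction.\<close>

lemma acyclic_fib_from_least:
  assumes cross: "\<And>p q. step p q \<Longrightarrow> W p q \<Longrightarrow> \<exists>a b. W a b \<and> F a b \<and> a \<sqsubseteq> p \<and> q \<sqsubseteq> b"
    and least: "\<And>c. W c a \<Longrightarrow> c = a" and ay: "W a y"
  shows "F a y"
proof (rule ccontr)
  assume "\<not> F a y"
  then have "{y. W a y \<and> \<not> F a y} \<noteq> {}" "{y. W a y \<and> \<not> F a y} \<subseteq> A"
    using ay weq_le le_carrier by auto
  from ex_least[OF this(2,1)] obtain y where y: "W a y" "\<not> F a y"
    and min: "\<And>z. W a z \<Longrightarrow> \<not> F a z \<Longrightarrow> y \<sqsubseteq> z" by blast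
  have "a \<noteq> y" using y left_right_refl[OF fib_sys] le_carrier weq_le by blast
  then obtain p where p: "step p y" "a \<sqsubseteq> p" using ex_step_below y weq_le by blast
  then have "W p y" using weq_convex(2) y unfolding step_def by blast
  then obtain c d where cd: "W c d" "F c d" "c \<sqsubseteq> p" "y \<sqsubseteq> d" using cross p(1) by blast
  then have "c \<sqsubseteq> y" using p le_trans unfolding step_def by blast
  then have cy: "W c y" "F c y" using right_restrict[OF cof_sys, of c d y] cd by auto
  have "a \<sqsubseteq> c"
  proof (rule ccontr)
    assume n: "\<not> a \<sqsubseteq> c"
    then have "c \<sqsubseteq> a" using le_total le_carrier cd(3) p(2) by blast
    then have "W c a" using weq_convex(1)[OF cy(1)] y weq_le by blast
    then show False using least n le_refl le_carrier cd(3) by blast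
  qed
  then have "W a c" using weq_convex(1)[OF y(1)] \<open>c \<sqsubseteq> y\<close> by blast
  moreover have "\<not> y \<sqsubseteq> c" using cd(3) p(1) le_trans le_antisym unfolding step_def by blast
  ultimately have "F a c" using min by blast
  then show False using right_trans[OF fib_sys] cy y by blast
qed

text \<open>Otherwise every step of the block \<open>[a, b]\<close> of \<open>x\<close> would be crossed by both kinds of
  acyclic maps, making \<open>a \<rightarrow> b\<close> an acyclic cofibration and an acyclic fibration.\<close>

lemma ex_uncrossed_step:
  assumes "W x y" "x \<noteq> y"
  obtains
    (fib) p q where "step p q" "W p q" "\<And>a b. W a b \<Longrightarrow> F a b \<Longrightarrow> \<not> (a \<sqsubseteq> p \<and> q \<sqsubseteq> b)"
  | (cof) p q where "step p q" "W p q" "\<And>a b. W a b \<Longrightarrow> K a b \<Longrightarrow> \<not> (a \<sqsubseteq> p \<and> q \<sqsubseteq> b)"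
proof (rule ccontr)
  assume "\<not> thesis"
  then have crossF: "\<exists>a b. W a b \<and> F a b \<and> a \<sqsubseteq> p \<and> q \<sqsubseteq> b"
    and crossK: "\<exists>a b. W a b \<and> K a b \<and> a \<sqsubseteq> p \<and> q \<sqsubseteq> b" if "step p q" "W p q" for p q
    using fib[of p q] cof[of p q] that by blast+
  let ?S = "{c. W c x}"
  have "?S \<subseteq> A" "x \<in> ?S" using assms weq_le le_carrier weq_refl by blast+
  then obtain a where a: "W a x" "\<And>c. W c x \<Longrightarrow> a \<sqsubseteq> c" using ex_least[of ?S] by auto
  have a_least: "c = a" if "W c a" for c
    using that a weq_comp weq_le le_antisym by blast
  let ?T = "{c. W y c}"
  have "?T \<subseteq> A" "y \<in> ?T" using assms weq_le le_carrier weq_refl by blast+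
  then obtain b where b: "W y b" "\<And>c. W y c \<Longrightarrow> c \<sqsubseteq> b" using ex_greatest[of ?T] by auto
  have b_greatest: "c = b" if "W b c" for c
    using that b weq_comp weq_le le_antisym by blast
  have ab: "W a b" using a b assms weq_comp by blast
  have "F a b" using acyclic_fib_from_least[of a b] crossF a_least ab by blast
  \<comment> \<open>In the reversed order the block starts at \<open>b\<close>, and cofibrations
    play the part of fibrations.\<close>
  moreover have "K a b"
    using chain_model.acyclic_fib_from_least[OF converse_model, of b a] crossK b_greatest ab
    by (simp add: step_converse) blast
  moreover have "a \<sqsubseteq> a" "b \<sqsubseteq> b" using ab weq_le le_refl le_carrier by blast+
  \<comment> \<open>Lift \<open>a -> b\<close> against itself.\<close>
  ultimately have "b \<sqsubseteq> a" using lift[OF cof_sys, of a b a b] ab by auto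
  then have "x = y" using a b assms(1) weq_le le_trans le_antisym by metis
  then show False using assms by simp
qed

end

section \<open>Empty and one-point simplicial sets\<close>

text \<open>Empty or a point. The levels are required to be literally the same set, as happens for
  hom sets between constant resolutions.\<close>

definition subterminal_sset :: "'s sset \<Rightarrow> bool" where
  "subterminal_sset S \<longleftrightarrow>
     (\<forall>m. simplices S m = simplices S 0) \<and>
     (\<forall>x\<in>simplices S 0. \<forall>y\<in>simplices S 0. x = y) \<and>
     (\<forall>k m. \<forall>\<theta>\<in>delta k m. \<forall>x\<in>simplices S 0. sset_act S k m \<theta> x \<in> simplices S 0)"

section \<open>Realizations of empty and one-point simplicial sets\<close>

lemma topspace_cells_top:
  "topspace (cells_top S) = {((m, x), t). x \<in> simplices S m \<and> t \<in> standard_simplex m}"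
  by (auto simp: cells_top_def)

lemma push_simplex_in_standard_simplex:
  assumes \<theta>: "\<theta> \<in> delta k m" and t: "t \<in> standard_simplex k"
  shows "push_simplex k \<theta> t \<in> standard_simplex m"
proof -
  have t0: "0 \<le> t i" for i using t by (auto simp: standard_simplex_def)
  have t1: "(\<Sum>i\<le>k. t i) = 1" using t by (auto simp: standard_simplex_def)
  have ran: "\<theta> i \<le> m" if "i \<le> k" for i using \<theta> that by (auto simp: delta_def)
  have "push_simplex k \<theta> t j \<le> (\<Sum>i\<le>k. t i)" for j
    unfolding push_simplex_def by (rule sum_mono2) (use t0 in auto)
  moreover have "0 \<le> push_simplex k \<theta> t j" for j
    unfolding push_simplex_def by (rule sum_nonneg) (use t0 in auto)
  moreover have "push_simplex k \<theta> t j = 0" if "j > m" for j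
  proof -
    have "{i. i \<le> k \<and> \<theta> i = j} = {}" using ran that by (auto simp flip: not_le)
    then show ?thesis unfolding push_simplex_def by (simp only: sum.empty)
  qed
  \<comment> \<open>The fibres of \<open>\<theta>\<close> partition \<open>{..k}\<close>, so the
    total weight is preserved.\<close>
  moreover have "(\<Sum>j\<le>m. push_simplex k \<theta> t j) = 1"
    using sum.group[of "{..k}" "{..m}" \<theta> t] ran t1 by (auto simp: push_simplex_def)
  ultimately show ?thesis using t1 by (simp add: standard_simplex_def)
qed

text \<open>Since \<open>E\<close> lives on the whole type, classes of points of \<open>X\<close>
  might leave \<open>X\<close>; the second hypothesis makes the set of all these classes
  open.\<close>

lemma topspace_quotient_top:
  assumes "equiv UNIV E" "openin X (\<Union>(topspace X // E))"
  shows "topspace (quotient_top X E) = topspace X // E"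
  using assms unfolding topspace_def[of "quotient_top X E"] by (auto simp: openin_quotient_top)

lemma topspace_realization_empty:
  assumes "\<And>m. simplices S m = {}"
  shows "topspace (realization S) = {}"
proof -
  have "topspace (cells_top S) = {}" using assms by (auto simp: topspace_cells_top)
  then show ?thesis
    unfolding realization_def by (subst topspace_quotient_top[OF equiv_glue_eq]) auto
qed

text \<open>Every point of every cell is glued to the single vertex \<open>?b\<close> by the
  degeneracy to \<open>[0]\<close>, and gluing never leaves the space of cells.\<close>

lemma glue_eq_point:
  assumes s: "\<And>m. simplices S m = {s}" and act: "\<And>k m \<theta>. \<theta> \<in> delta k m \<Longrightarrow> sset_act S k m \<theta> s = s"
    and c: "c \<in> topspace (cells_top S)"
  shows "glue_eq S `` {c} = topspace (cells_top S)"
proof -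
  let ?T = "topspace (cells_top S)"
  have gl: "gluing S \<subseteq> ?T \<times> ?T"
    using s act push_simplex_in_standard_simplex by (auto simp: gluing_def topspace_cells_top)
  have *: "y \<in> ?T" if "(x, y) \<in> glue_eq S" "x \<in> ?T" for x y
    using that(1) unfolding glue_eq_def
    by (induction rule: rtrancl_induct) (use gl that(2) in auto)
  let ?b = "((0, s), \<lambda>j. if j = 0 then 1 else 0 :: real)"
  have base: "(x, ?b) \<in> glue_eq S" if x_in: "x \<in> ?T" for x
  proof -
    obtain m t where x: "x = ((m, s), t)" and t: "t \<in> standard_simplex m"
      using x_in s by (auto simp: topspace_cells_top)
    \<comment> \<open>The map \<open>[m] -> [0]\<close> collects all barycentric coordinates, whose
      sum is 1, in position 0.\<close>
    let ?\<theta> = "\<lambda>i\<in>{..m}. 0::nat"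
    have \<theta>: "?\<theta> \<in> delta m 0" by (auto simp: delta_def mono_on_def)
    have "push_simplex m ?\<theta> t j = (if j = 0 then 1 else 0)" for j
    proof -
      have "{i. i \<le> m \<and> ?\<theta> i = j} = (if j = 0 then {..m} else {})" by auto
      then show ?thesis using t by (simp add: push_simplex_def standard_simplex_def)
    qed
    then have "push_simplex m ?\<theta> t = (\<lambda>j. if j = 0 then 1 else 0)" by blast
    moreover have "(((m, sset_act S m 0 ?\<theta> s), t), ((0, s), push_simplex m ?\<theta> t)) \<in> gluing S"
      unfolding gluing_def using \<theta> s t by blast
    ultimately have "(x, ?b) \<in> gluing S" using act[OF \<theta>] x by simp
    then show ?thesis unfolding glue_eq_def by blast
  qed
  have "(c, y) \<in> glue_eq S" if "y \<in> ?T" for y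
    using base[OF c] base[OF that] equiv_glue_eq[of S] by (meson equivE symE transE)
  then show ?thesis using * c by auto
qed

lemma topspace_realization_point:
  assumes s: "\<And>m. simplices S m = {s}" and act: "\<And>k m \<theta>. \<theta> \<in> delta k m \<Longrightarrow> sset_act S k m \<theta> s = s"
  shows "topspace (realization S) = {topspace (cells_top S)}"
    and "topspace (cells_top S) \<noteq> {}"
proof -
  have "((0, s), \<lambda>j. if j = 0 then 1 else 0) \<in> topspace (cells_top S)"
    using s by (auto simp: topspace_cells_top standard_simplex_def)
  then show ne: "topspace (cells_top S) \<noteq> {}" by blast
  then have "topspace (cells_top S) // glue_eq S = {topspace (cells_top S)}"
    using glue_eq_point[OF s act] by (auto simp: quotient_def)
  then show "topspace (realization S) = {topspace (cells_top S)}"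
    unfolding realization_def by (subst topspace_quotient_top[OF equiv_glue_eq]) auto
qed

section \<open>Weak equivalences between subterminal simplicial sets\<close>

lemma homotopy_equivalence_same_topspace_empty:
  "homotopy_equivalence X Y f \<Longrightarrow> topspace X = {} \<longleftrightarrow> topspace Y = {}"
  unfolding homotopy_equivalence_def continuous_map_def by blast

lemma homotopy_equivalence_subsingleton:
  assumes X: "\<And>x x'. x \<in> topspace X \<Longrightarrow> x' \<in> topspace X \<Longrightarrow> x = x'"
    and Y: "\<And>y y'. y \<in> topspace Y \<Longrightarrow> y' \<in> topspace Y \<Longrightarrow> y = y'"
    and f: "\<And>x. x \<in> topspace X \<Longrightarrow> f x \<in> topspace Y"
    and ne: "topspace Y \<noteq> {} \<Longrightarrow> topspace X \<noteq> {}"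
  shows "homotopy_equivalence X Y f"
proof -
  obtain a where a: "a \<in> topspace X" if "topspace Y \<noteq> {}" using ne by blast
  \<comment> \<open>On a space with at most one point \<open>f\<close> agrees with a constant map;
    the homotopy inverse is constant as well.\<close>
  have cf: "continuous_map X Y f"
    by (rule continuous_map_eq[of X Y "\<lambda>_. f (SOME x. x \<in> topspace X)"])
      (use X f in \<open>auto simp: some_in_eq intro: arg_cong[of _ _ f] someI\<close>)
  have cg: "continuous_map Y X (\<lambda>_. a)" using a by auto
  have "homotopic_with (\<lambda>x. True) X X ((\<lambda>_. a) \<circ> f) id"
    by (rule homotopic_with_equal)
      (use X a f continuous_map_compose[OF cf cg] in \<open>auto simp: o_def\<close>)
  moreover have "homotopic_with (\<lambda>x. True) Y Y (f \<circ> (\<lambda>_. a)) id"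
    by (rule homotopic_with_equal)
      (use Y a f continuous_map_compose[OF cg cf] in \<open>auto simp: o_def\<close>)
  ultimately show ?thesis using cf cg unfolding homotopy_equivalence_def by blast
qed

lemma subterminal_sset_cases:
  assumes "subterminal_sset S"
  obtains (empty) "\<And>m. simplices S m = {}"
  | (point) s where "\<And>m. simplices S m = {s}"
      "\<And>k m \<theta>. \<theta> \<in> delta k m \<Longrightarrow> sset_act S k m \<theta> s = s"
proof (cases "simplices S 0 = {}")
  case True
  then show ?thesis using assms empty unfolding subterminal_sset_def by metis
next
  case False
  then obtain s where "s \<in> simplices S 0" by blast
  then have s: "simplices S 0 = {s}" using assms unfolding subterminal_sset_def by blast
  show ?thesis by (rule point[of s]) (use assms s in \<open>auto simp: subterminal_sset_def\<close>)
qed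

lemma topspace_realization_subterminal:
  assumes "subterminal_sset S"
  shows "topspace (realization S) = (if simplices S 0 = {} then {} else {topspace (cells_top S)})"
  using assms
  by (cases rule: subterminal_sset_cases)
    (simp_all add: topspace_realization_empty topspace_realization_point(1))

text \<open>Both realizations have at most one point, so only emptiness can distinguish
  them.\<close>

lemma sset_weak_equiv_subterminal_iff:
  assumes S: "subterminal_sset S" and T: "subterminal_sset T"
    and f: "\<And>m x. x \<in> simplices S m \<Longrightarrow> f m x \<in> simplices T m"
  shows "sset_weak_equiv S T f \<longleftrightarrow> (simplices S 0 = {} \<longleftrightarrow> simplices T 0 = {})"
proof
  assume "sset_weak_equiv S T f"
  then have "topspace (realization S) = {} \<longleftrightarrow> topspace (realization T) = {}"
    unfolding sset_weak_equiv_def by (rule homotopy_equivalence_same_topspace_empty)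
  then show "simplices S 0 = {} \<longleftrightarrow> simplices T 0 = {}"
    by (simp add: topspace_realization_subterminal S T split: if_splits)
next
  assume iff: "simplices S 0 = {} \<longleftrightarrow> simplices T 0 = {}"
  show "sset_weak_equiv S T f"
    unfolding sset_weak_equiv_def
  proof (rule homotopy_equivalence_subsingleton)
    fix c assume c: "c \<in> topspace (realization S)"
    then have c': "c = topspace (cells_top S)" and "simplices S 0 \<noteq> {}"
      using topspace_realization_subterminal[OF S] by (auto split: if_splits)
    then obtain s where s: "\<And>m. simplices S m = {s}"
      "\<And>k m \<theta>. \<theta> \<in> delta k m \<Longrightarrow> sset_act S k m \<theta> s = s"
      by - (rule subterminal_sset_cases[OF S]; simp)
    obtain t where t: "\<And>m. simplices T m = {t}"
      "\<And>k m \<theta>. \<theta> \<in> delta k m \<Longrightarrow> sset_act T k m \<theta> t = t"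
      using \<open>simplices S 0 \<noteq> {}\<close> iff by - (rule subterminal_sset_cases[OF T]; simp)
    \<comment> \<open>All members of the union defining \<open>realization_map\<close> are the same
      class; as \<open>c\<close> is nonempty, the union is that class.\<close>
    have "glue_eq T `` {((m, f m x), u)} = topspace (cells_top T)" if "((m, x), u) \<in> c" for m x u
      by (rule glue_eq_point[OF t]) (use that f in \<open>auto simp: c' topspace_cells_top\<close>)
    moreover have "c \<noteq> {}" unfolding c' by (rule topspace_realization_point(2)[OF s])
    ultimately have "realization_map T f c = topspace (cells_top T)"
      unfolding realization_map_def by (fastforce split: prod.split)
    then show "realization_map T f c \<in> topspace (realization T)"
      using topspace_realization_point(1)[OF t] by simp
  qed (use iff in \<open>simp_all add: topspace_realization_subterminal[OF S]
      topspace_realization_subterminal[OF T] split: if_splits\<close>)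
qed

section \<open>Thin linear categories and their opposites\<close>

text \<open>Turns a set of arrows into a relation on objects. In a thin category a set of arrows can
  be recovered from it.\<close>

definition hom_rel :: "('o, 'a) cat \<Rightarrow> 'a set \<Rightarrow> 'o \<Rightarrow> 'o \<Rightarrow> bool" where
  "hom_rel C S x y \<longleftrightarrow> S \<inter> arrows C x y \<noteq> {}"

section \<open>Duality for categories and model structures\<close>

lemma op_cat_simps [simp]:
  "Obj (op_cat C) = Obj C" "Arr (op_cat C) = Arr C" "Dom (op_cat C) = Cod C"
  "Cod (op_cat C) = Dom C" "Id (op_cat C) = Id C" "Comp (op_cat C) g f = Comp C f g"
  by (simp_all add: op_cat_def)

lemma arrows_op_cat [simp]: "arrows (op_cat C) x y = arrows C y x"
  by (auto simp: arrows_def)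

lemma op_op_cat [simp]: "op_cat (op_cat C) = C"
  by (simp add: op_cat_def)

lemma op_model_simps [simp]:
  "Weq (op_model M) = Weq M" "Cof (op_model M) = Fib M" "Fib (op_model M) = Cof M"
  by (simp_all add: op_model_def)

lemma op_op_model [simp]: "op_model (op_model M) = M"
  by (simp add: op_model_def)

lemma hom_rel_op_cat [simp]: "hom_rel (op_cat C) S = (hom_rel C S)\<inverse>\<inverse>"
  by (simp add: fun_eq_iff hom_rel_def)

lemma category_op_cat: "category C \<Longrightarrow> category (op_cat C)"
  unfolding category_def by auto

lemma fibrant_op: "fibrant (op_cat C) (op_model M) = cofibrant C M"
  by (simp add: fun_eq_iff fibrant_def cofibrant_def terminal_obj_def initial_obj_def)

text \<open>The properties of \<open>[n]\<close> used below, chosen to be invariant under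
  \<open>op_cat\<close> so that every result also holds in dual form.\<close>

locale chain_cat =
  fixes C :: "('o, 'a) cat"
  assumes category: "category C"
    and finite_obj: "finite (Obj C)"
    and thin: "f \<in> arrows C x y \<Longrightarrow> g \<in> arrows C x y \<Longrightarrow> f = g"
    and skeletal: "f \<in> arrows C x y \<Longrightarrow> g \<in> arrows C y x \<Longrightarrow> x = y"
    and linear: "x \<in> Obj C \<Longrightarrow> y \<in> Obj C \<Longrightarrow> arrows C x y \<noteq> {} \<or> arrows C y x \<noteq> {}"
begin

lemma op_chain_cat: "chain_cat (op_cat C)"
  by unfold_locales
    (use category category_op_cat finite_obj thin skeletal linear in auto)

lemma Id_in: "x \<in> Obj C \<Longrightarrow> Id C x \<in> arrows C x x"
  using category by (simp add: category_def)

lemma Comp_in: "f \<in> arrows C x y \<Longrightarrow> g \<in> arrows C y z \<Longrightarrow> Comp C g f \<in> arrows C x z"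
  using category unfolding category_def arrows_def by auto

lemma arrow_obj: "f \<in> arrows C x y \<Longrightarrow> x \<in> Obj C \<and> y \<in> Obj C"
  using category unfolding category_def arrows_def by auto

lemma in_arrows: "f \<in> Arr C \<Longrightarrow> f \<in> arrows C (Dom C f) (Cod C f)"
  by (simp add: arrows_def)

section \<open>Translation of classes of arrows into relations\<close>

abbreviation below where "below \<equiv> hom_rel C (Arr C)"

lemma below_iff: "below x y \<longleftrightarrow> arrows C x y \<noteq> {}"
  by (auto simp: hom_rel_def arrows_def)

sublocale finite_chain "Obj C" below
proof
  show "finite (Obj C)" by (rule finite_obj)
  show "x \<in> Obj C \<and> y \<in> Obj C" if "below x y" for x y
    using that arrow_obj by (auto simp: below_iff)
  show "below x x" if "x \<in> Obj C" for x using that Id_in by (auto simp: below_iff)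
  show "below x z" if "below x y" "below y z" for x y z
    using that Comp_in unfolding below_iff by blast
  show "x = y" if "below x y" "below y x" for x y
    using that skeletal unfolding below_iff by blast
  show "below x y \<or> below y x" if "x \<in> Obj C" "y \<in> Obj C" for x y
    using that linear unfolding below_iff by blast
qed

lemma hom_relI: "f \<in> S \<Longrightarrow> f \<in> arrows C x y \<Longrightarrow> hom_rel C S x y"
  by (auto simp: hom_rel_def)

lemma mem_iff_hom_rel:
  assumes "f \<in> arrows C x y"
  shows "f \<in> S \<longleftrightarrow> hom_rel C S x y"
  using assms thin[OF assms] unfolding hom_rel_def by blast

lemma hom_rel_Int: "hom_rel C (S \<inter> T) = inf (hom_rel C S) (hom_rel C T)"
proof (intro ext)
  fix x y
  have "hom_rel C (S \<inter> T) x y" if ST: "hom_rel C S x y" "hom_rel C T x y"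
  proof -
    obtain f where "f \<in> S" "f \<in> arrows C x y" using ST(1) by (auto simp: hom_rel_def)
    then show ?thesis using mem_iff_hom_rel[of f x y] ST(2) by blast
  qed
  then show "hom_rel C (S \<inter> T) x y \<longleftrightarrow> inf (hom_rel C S) (hom_rel C T) x y"
    by (auto simp: hom_rel_def)
qed

lemma hom_rel_le: "hom_rel C S x y \<Longrightarrow> below x y"
  by (auto simp: hom_rel_def arrows_def)

lemma hom_rel_Collect:
  assumes "\<And>x y. P x y \<Longrightarrow> below x y"
  shows "hom_rel C {f \<in> Arr C. P (Dom C f) (Cod C f)} = P"
proof (intro ext iffI)
  fix x y assume "P x y"
  then obtain f where "f \<in> arrows C x y" using assms below_iff by blast
  then show "hom_rel C {f \<in> Arr C. P (Dom C f) (Cod C f)} x y"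
    using \<open>P x y\<close> by (auto simp: hom_rel_def arrows_def)
qed (auto simp: hom_rel_def arrows_def)

lemma has_lifting_iff:
  assumes "i \<in> arrows C a b" "p \<in> arrows C c d"
  shows "has_lifting C i p \<longleftrightarrow> (below a c \<longrightarrow> below b d \<longrightarrow> below b c)"
proof -
  have *: "Dom C i = a" "Cod C i = b" "Dom C p = c" "Cod C p = d"
    using assms by (auto simp: arrows_def)
  have "Comp C p u = Comp C v i" if "u \<in> arrows C a c" "v \<in> arrows C b d" for u v
    using that assms Comp_in thin by meson
  moreover have "Comp C h i = u" if "u \<in> arrows C a c" "h \<in> arrows C b c" for u h
    using that assms Comp_in thin by meson
  moreover have "Comp C p h = v" if "v \<in> arrows C b d" "h \<in> arrows C b c" for v h
    using that assms Comp_in thin by meson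
  ultimately show ?thesis unfolding has_lifting_def * below_iff by blast
qed

text \<open>The sections and retractions give maps both ways between the domains and between the
  codomains.\<close>

lemma retract_of_arrow_eq:
  assumes "f \<in> Arr C" "g \<in> Arr C" "retract_of_arrow C f g"
  shows "f = g"
proof -
  have "Dom C f = Dom C g" "Cod C f = Cod C g"
    using assms(3) skeletal unfolding retract_of_arrow_def by blast+
  then show ?thesis using assms(1,2) thin in_arrows by metis
qed

lemma wfs_iff:
  assumes "L \<subseteq> Arr C" "R \<subseteq> Arr C"
  shows "weak_factorization_system C L R \<longleftrightarrow> fact_sys below (hom_rel C L) (hom_rel C R)"
proof -
  have "closed_under_retracts C S" if "S \<subseteq> Arr C" for S
    using that retract_of_arrow_eq unfolding closed_under_retracts_def by blast
  moreover have "(\<forall>i\<in>L. \<forall>p\<in>R. has_lifting C i p) \<longleftrightarrow>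
    (\<forall>a b c d. hom_rel C L a b \<longrightarrow> hom_rel C R c d \<longrightarrow> below a c \<longrightarrow> below b d \<longrightarrow> below b c)"
    (is "?l \<longleftrightarrow> ?r")
  proof
    assume ?l
    then show ?r using has_lifting_iff by (fastforce simp: hom_rel_def[of C L] hom_rel_def[of C R])
  next
    assume r: ?r
    show ?l
    proof (intro ballI)
      fix i p assume ip: "i \<in> L" "p \<in> R"
      then have arr: "i \<in> arrows C (Dom C i) (Cod C i)" "p \<in> arrows C (Dom C p) (Cod C p)"
        using assms in_arrows by blast+
      then have "hom_rel C L (Dom C i) (Cod C i)" "hom_rel C R (Dom C p) (Cod C p)"
        using ip by (simp_all add: mem_iff_hom_rel[symmetric])
      then show "has_lifting C i p" using r has_lifting_iff[OF arr] by blast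
    qed
  qed
  moreover have "(\<forall>f\<in>Arr C. \<exists>i\<in>L. \<exists>p\<in>R. Cod C i = Dom C p \<and> Comp C p i = f) \<longleftrightarrow>
    (\<forall>x y. below x y \<longrightarrow> (\<exists>z. hom_rel C L x z \<and> hom_rel C R z y))" (is "?l \<longleftrightarrow> ?r")
  proof
    assume l: ?l
    show ?r
    proof (intro allI impI)
      fix x y assume "below x y"
      then obtain f where f: "f \<in> Arr C" "f \<in> arrows C x y" by (auto simp: hom_rel_def)
      then obtain i p where ip: "i \<in> L" "p \<in> R" "Cod C i = Dom C p" "Comp C p i = f" using l by blast
      have i: "i \<in> arrows C (Dom C i) (Dom C p)" and p: "p \<in> arrows C (Dom C p) (Cod C p)"
        using ip(1-3) assms by (auto simp: arrows_def)
      have "f \<in> arrows C (Dom C i) (Cod C p)" using Comp_in[OF i p] ip(4) by simp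
      then have "Dom C i = x" "Cod C p = y" using f by (auto simp: arrows_def)
      then have "hom_rel C L x (Dom C p)" "hom_rel C R (Dom C p) y"
        using hom_relI[OF ip(1) i] hom_relI[OF ip(2) p] by simp_all
      then show "\<exists>z. hom_rel C L x z \<and> hom_rel C R z y" by blast
    qed
  next
    assume r: ?r
    show ?l
    proof
      fix f assume f: "f \<in> Arr C"
      then obtain z where "hom_rel C L (Dom C f) z" "hom_rel C R z (Cod C f)"
        using r hom_relI[OF f in_arrows[OF f]] by blast
      then obtain i p where ip: "i \<in> L" "i \<in> arrows C (Dom C f) z" "p \<in> R" "p \<in> arrows C z (Cod C f)"
        by (auto simp: hom_rel_def)
      then have "Comp C p i = f" using thin[OF Comp_in in_arrows[OF f]] by blast
      moreover have "Cod C i = Dom C p" using ip by (simp add: arrows_def)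
      ultimately show "\<exists>i\<in>L. \<exists>p\<in>R. Cod C i = Dom C p \<and> Comp C p i = f"
        using ip by blast
    qed
  qed
  moreover have "hom_rel C L \<le> below" "hom_rel C R \<le> below" using hom_rel_le by blast+
  ultimately show ?thesis using assms unfolding weak_factorization_system_def fact_sys_def by simp
qed

lemma two_out_of_three_iff:
  assumes "W \<subseteq> Arr C"
  shows "two_out_of_three C W \<longleftrightarrow>
    (\<forall>x y z. below x y \<longrightarrow> below y z \<longrightarrow>
      (hom_rel C W x y \<and> hom_rel C W y z \<longrightarrow> hom_rel C W x z) \<and>
      (hom_rel C W x y \<and> hom_rel C W x z \<longrightarrow> hom_rel C W y z) \<and>
      (hom_rel C W y z \<and> hom_rel C W x z \<longrightarrow> hom_rel C W x y))" (is "_ \<longleftrightarrow> (\<forall>x y z. ?P x y z)")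
proof -
  have *: "(f \<in> W \<and> g \<in> W \<longrightarrow> Comp C g f \<in> W) \<and> (f \<in> W \<and> Comp C g f \<in> W \<longrightarrow> g \<in> W) \<and>
      (g \<in> W \<and> Comp C g f \<in> W \<longrightarrow> f \<in> W) \<longleftrightarrow> ?P x y z"
    if f: "f \<in> arrows C x y" and g: "g \<in> arrows C y z" for x y z f g
    using mem_iff_hom_rel[OF f, of W] mem_iff_hom_rel[OF g, of W]
      mem_iff_hom_rel[OF Comp_in[OF f g], of W] f g below_iff by auto
  show ?thesis
  proof
    assume l: "two_out_of_three C W"
    have "?P x y z" if xyz: "below x y" "below y z" for x y z
    proof -
      obtain f g where fg: "f \<in> arrows C x y" "g \<in> arrows C y z"
        using xyz unfolding below_iff by blast
      then have "f \<in> Arr C" "g \<in> Arr C" "Cod C f = Dom C g" by (auto simp: arrows_def)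
      then show ?thesis using l *[OF fg] unfolding two_out_of_three_def by blast
    qed
    then show "\<forall>x y z. ?P x y z" by blast
  next
    assume r: "\<forall>x y z. ?P x y z"
    show "two_out_of_three C W"
      unfolding two_out_of_three_def
    proof (intro ballI impI)
      fix f g assume "f \<in> Arr C" "g \<in> Arr C" "Cod C f = Dom C g"
      then have "f \<in> arrows C (Dom C f) (Dom C g)" "g \<in> arrows C (Dom C g) (Cod C g)"
        by (auto simp: arrows_def)
      from *[OF this] r
      show "(f \<in> W \<and> g \<in> W \<longrightarrow> Comp C g f \<in> W) \<and> (f \<in> W \<and> Comp C g f \<in> W \<longrightarrow> g \<in> W) \<and>
        (g \<in> W \<and> Comp C g f \<in> W \<longrightarrow> f \<in> W)" by blast
    qed
  qed
qed

text \<open>The bridge to the order-theoretic part. The inclusions are stated separately because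
  \<open>hom_rel\<close> sees only members of \<open>Arr C\<close>.\<close>

lemma model_structure_iff:
  "model_structure C M \<longleftrightarrow> Weq M \<subseteq> Arr C \<and> Cof M \<subseteq> Arr C \<and> Fib M \<subseteq> Arr C \<and>
     chain_model (Obj C) below (hom_rel C (Weq M)) (hom_rel C (Cof M)) (hom_rel C (Fib M))"
proof (cases "Weq M \<subseteq> Arr C \<and> Cof M \<subseteq> Arr C \<and> Fib M \<subseteq> Arr C")
  case True
  then have "weak_factorization_system C (Cof M) (Weq M \<inter> Fib M) \<longleftrightarrow>
      fact_sys below (hom_rel C (Cof M)) (inf (hom_rel C (Weq M)) (hom_rel C (Fib M)))"
    "weak_factorization_system C (Weq M \<inter> Cof M) (Fib M) \<longleftrightarrow>
      fact_sys below (inf (hom_rel C (Weq M)) (hom_rel C (Cof M))) (hom_rel C (Fib M))"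
    by (simp_all add: wfs_iff le_infI1 flip: hom_rel_Int)
  then show ?thesis
    using True finite_chain_axioms
    unfolding model_structure_def two_out_of_three_iff[OF conjunct1[OF True]]
      chain_model_def chain_model_axioms_def
    by (meson hom_rel_le)
next
  case False
  then show ?thesis by (auto simp: model_structure_def weak_factorization_system_def)
qed

lemma model_structure_op:
  "model_structure C M \<Longrightarrow> model_structure (op_cat C) (op_model M)"
  using chain_model.converse_model unfolding model_structure_iff chain_cat.model_structure_iff[OF op_chain_cat]
  by auto

end

section \<open>Mapping spaces and localizations\<close>

lemma realization_cong:
  assumes "\<And>m. simplices S m = simplices S' m"
    and "\<And>k m \<theta> x. \<theta> \<in> delta k m \<Longrightarrow> x \<in> simplices S m \<Longrightarrow> sset_act S k m \<theta> x = sset_act S' k m \<theta> x"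
  shows "glue_eq S = glue_eq S'" "realization S = realization S'"
proof -
  have "gluing S = gluing S'"
    unfolding gluing_def using assms by (auto; metis)
  then show "glue_eq S = glue_eq S'" by (simp add: glue_eq_def)
  then show "realization S = realization S'"
    using assms(1) by (simp add: realization_def cells_top_def)
qed

lemma cosimplicial_object_cmap:
  "cosimplicial_object C X \<Longrightarrow> \<theta> \<in> delta k m \<Longrightarrow> cmap X k m \<theta> \<in> arrows C (cobj X k) (cobj X m)"
  by (simp add: cosimplicial_object_def)

text \<open>The actions differ by associativity, which holds for genuine arrows only. The records
  may thus differ as functions, but their gluing relations and realizations agree.\<close>

lemma map_space_op:
  assumes C: "category C" and X: "cosimplicial_object C X" and Y: "cosimplicial_object (op_cat C) Y"
  shows "glue_eq (map_space (op_cat C) Y X) = glue_eq (map_space C X Y)"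
    "realization (map_space (op_cat C) Y X) = realization (map_space C X Y)"
proof -
  have act: "sset_act (map_space (op_cat C) Y X) k m \<theta> h = sset_act (map_space C X Y) k m \<theta> h"
    if \<theta>: "\<theta> \<in> delta k m" and h: "h \<in> simplices (map_space (op_cat C) Y X) m" for k m \<theta> h
  proof -
    have "cmap X k m \<theta> \<in> arrows C (cobj X k) (cobj X m)" "cmap Y k m \<theta> \<in> arrows C (cobj Y m) (cobj Y k)"
      using cosimplicial_object_cmap[OF X \<theta>] cosimplicial_object_cmap[OF Y \<theta>] by simp_all
    moreover have "h \<in> arrows C (cobj X m) (cobj Y m)" using h by (simp add: map_space_def)
    ultimately show ?thesis
      using C unfolding category_def arrows_def by (simp add: map_space_def)
  qed
  have levels: "simplices (map_space (op_cat C) Y X) m = simplices (map_space C X Y) m" for m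
    by (simp add: map_space_def)
  show "glue_eq (map_space (op_cat C) Y X) = glue_eq (map_space C X Y)"
    "realization (map_space (op_cat C) Y X) = realization (map_space C X Y)"
    using realization_cong[OF levels act] by blast+
qed

lemma sset_weak_equiv_map_space_op:
  assumes "category C" "cosimplicial_object C Z"
    and "cosimplicial_object (op_cat C) X" "cosimplicial_object (op_cat C) Y"
  shows "sset_weak_equiv (map_space (op_cat C) X Z) (map_space (op_cat C) Y Z) \<phi> \<longleftrightarrow>
    sset_weak_equiv (map_space C Z X) (map_space C Z Y) \<phi>"
proof -
  have "realization_map (map_space (op_cat C) Y Z) \<phi> = realization_map (map_space C Z Y) \<phi>"
    unfolding realization_map_def map_space_op(1)[OF assms(1,2,4)] ..
  then show ?thesis
    unfolding sset_weak_equiv_def map_space_op(2)[OF assms(1,2,3)] map_space_op(2)[OF assms(1,2,4)]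
    by simp
qed

lemma cosimplicial_resolution_object:
  "cosimplicial_resolution C M x X e \<Longrightarrow> cosimplicial_object C X"
  by (simp add: cosimplicial_resolution_def)

text \<open>Both sides ask for the same resolutions and maps; only the mapping spaces are formed in
  opposite categories.\<close>

lemma postcomp_weak_equiv_op:
  assumes C: "category C"
  shows "postcomp_weak_equiv C M f z \<longleftrightarrow> precomp_weak_equiv (op_cat C) (op_model M) f z"
    (is "?l \<longleftrightarrow> ?r")
proof
  assume ?l
  then obtain X eX Y eY \<psi> Z eZ where *: "simplicial_resolution C M (Dom C f) X eX"
    "simplicial_resolution C M (Cod C f) Y eY" "cosimplicial_map (op_cat C) Y X \<psi>"
    "\<forall>m. Comp C (\<psi> m) (eX m) = Comp C (eY m) f" "cosimplicial_resolution C M z Z eZ"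
    "sset_weak_equiv (map_space C Z X) (map_space C Z Y) (\<lambda>m h. Comp C (\<psi> m) h)"
    unfolding postcomp_weak_equiv_def by blast
  then have "sset_weak_equiv (map_space (op_cat C) X Z) (map_space (op_cat C) Y Z) (\<lambda>m h. Comp C (\<psi> m) h)"
    by (simp only: sset_weak_equiv_map_space_op[OF C *(5,1,2)[THEN cosimplicial_resolution_object]])
  with *(1-5) show ?r
    unfolding precomp_weak_equiv_def op_cat_simps op_op_cat op_op_model
    by (intro exI conjI) assumption+
next
  assume ?r
  then obtain X eX Y eY \<psi> Z eZ where *: "simplicial_resolution C M (Dom C f) X eX"
    "simplicial_resolution C M (Cod C f) Y eY" "cosimplicial_map (op_cat C) Y X \<psi>"
    "\<forall>m. Comp C (\<psi> m) (eX m) = Comp C (eY m) f" "cosimplicial_resolution C M z Z eZ"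
    and we: "sset_weak_equiv (map_space (op_cat C) X Z) (map_space (op_cat C) Y Z) (\<lambda>m h. Comp C (\<psi> m) h)"
    unfolding precomp_weak_equiv_def op_cat_simps op_op_cat op_op_model by blast
  from we have "sset_weak_equiv (map_space C Z X) (map_space C Z Y) (\<lambda>m h. Comp C (\<psi> m) h)"
    by (simp only: sset_weak_equiv_map_space_op[OF C *(5,1,2)[THEN cosimplicial_resolution_object]])
  with * show ?l
    unfolding postcomp_weak_equiv_def by (intro exI conjI) assumption+
qed

lemma colocal_equivs_op:
  assumes "category C"
  shows "colocal_equivs C M S = local_equivs (op_cat C) (op_model M) S"
  by (simp add: colocal_equivs_def local_equivs_def colocal_obj_def local_obj_def fibrant_op
      postcomp_weak_equiv_op[OF assms])

section \<open>Constancy of cosimplicial objects and of mapping spaces\<close>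

context chain_cat
begin

lemma terminal_obj_iff: "terminal_obj C t \<longleftrightarrow> t \<in> Obj C \<and> (\<forall>x\<in>Obj C. below x t)"
  unfolding terminal_obj_def below_iff using thin by blast

text \<open>The maps \<open>[0] -> [m]\<close> and \<open>[m] -> [0]\<close> induce arrows both ways
  between the two levels.\<close>

lemma cosimplicial_object_const:
  assumes "cosimplicial_object C X"
  shows "cobj X m = cobj X 0"
proof -
  have "(\<lambda>i\<in>{..0}. 0) \<in> delta 0 m" "(\<lambda>i\<in>{..m}. 0) \<in> delta m 0"
    by (auto simp: delta_def mono_on_def)
  then show ?thesis using assms skeletal unfolding cosimplicial_object_def by metis
qed

lemma subterminal_map_space:
  assumes X: "cosimplicial_object C X" and Y: "cosimplicial_object (op_cat C) Y"
  shows "subterminal_sset (map_space C X Y)"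
proof -
  interpret op: chain_cat "op_cat C" by (rule op_chain_cat)
  have levels: "simplices (map_space C X Y) m = arrows C (cobj X 0) (cobj Y 0)" for m
    using cosimplicial_object_const[OF X, of m] op.cosimplicial_object_const[OF Y, of m]
    by (simp add: map_space_def)
  have "sset_act (map_space C X Y) k m \<theta> h \<in> arrows C (cobj X 0) (cobj Y 0)"
    if "\<theta> \<in> delta k m" "h \<in> arrows C (cobj X 0) (cobj Y 0)" for k m \<theta> h
  proof -
    have "cmap X k m \<theta> \<in> arrows C (cobj X 0) (cobj X 0)" "cmap Y k m \<theta> \<in> arrows C (cobj Y 0) (cobj Y 0)"
      using cosimplicial_object_cmap[OF X that(1)] cosimplicial_object_cmap[OF Y that(1)]
        cosimplicial_object_const[OF X, of k] cosimplicial_object_const[OF X, of m]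
        op.cosimplicial_object_const[OF Y, of k] op.cosimplicial_object_const[OF Y, of m]
      by simp_all
    then show ?thesis using that(2) unfolding map_space_def by (auto intro: Comp_in)
  qed
  then show ?thesis unfolding subterminal_sset_def levels using thin by blast
qed

lemma right_localization_op:
  assumes "left_localization (op_cat C) (op_model M') S (op_model M)"
  shows "right_localization C M' S M"
  using assms chain_cat.model_structure_op[OF op_chain_cat, of "op_model M"]
  by (simp add: left_localization_def right_localization_def colocal_equivs_op category)

end

section \<open>Resolutions and mapping spaces for a model structure\<close>

locale model_chain_cat = chain_cat +
  fixes M :: "'b model_str"
  assumes model: "model_structure C M"
begin

abbreviation "weq \<equiv> hom_rel C (Weq M)"

sublocale chain_model "Obj C" below weq "hom_rel C (Cof M)" "hom_rel C (Fib M)"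
  using model by (simp add: model_structure_iff)

lemma op_model_chain_cat: "model_chain_cat (op_cat C) (op_model M)"
  using op_chain_cat model_structure_op[OF model]
  by (simp add: model_chain_cat_def model_chain_cat_axioms_def)

lemma fibrant_iff: "fibrant C M z \<longleftrightarrow> fib z"
proof
  assume "fibrant C M z"
  then show "fib z"
    unfolding fibrant_def fib_def terminal_obj_iff by (blast intro: hom_relI)
next
  assume "fib z"
  then obtain t where t: "\<forall>x\<in>Obj C. below x t" "hom_rel C (Fib M) z t" by (auto simp: fib_def)
  then obtain f where "f \<in> Fib M" "f \<in> arrows C z t" by (auto simp: hom_rel_def)
  then show "fibrant C M z"
    unfolding fibrant_def terminal_obj_iff using t(1) arrow_obj by blast
qed

lemma op_cofib: "chain_model.cofib (Obj C) below\<inverse>\<inverse> (hom_rel C (Fib M))\<inverse>\<inverse> = fib"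
  by (simp add: fun_eq_iff fib_def chain_model.cofib_def[OF converse_model])

text \<open>At level 0 the latching object is the colimit of the empty diagram, an initial object,
  so Reedy cofibrancy there is cofibrancy.\<close>

lemma cosimplicial_resolution_cofib:
  assumes "cosimplicial_resolution C M x X e"
  shows "cofib (cobj X 0) \<and> weq (cobj X 0) x"
proof
  obtain l c i where l: "latching_object C X 0 l c" and i: "i \<in> Cof M" "i \<in> arrows C l (cobj X 0)"
    using assms unfolding cosimplicial_resolution_def reedy_cofibrant_def by blast
  have "below l y" if "y \<in> Obj C" for y
  proof -
    have "latching_cocone C X 0 y c" using that by (simp add: latching_cocone_def)
    then show ?thesis using l unfolding latching_object_def below_iff by blast
  qed
  then show "cofib (cobj X 0)" using hom_relI[OF i] unfolding cofib_def by blast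
  show "weq (cobj X 0) x"
    using assms hom_relI unfolding cosimplicial_resolution_def by blast
qed

definition const_cosimp :: "'a \<Rightarrow> ('a, 'b) cosimp" where
  "const_cosimp c = \<lparr>cobj = (\<lambda>_. c), cmap = (\<lambda>_ _ _. Id C c)\<rparr>"

text \<open>In a thin category the colimit of a nonempty diagram constant at \<open>c\<close> is
  \<open>c\<close>. So the latching map in positive degrees is an identity, and level 0 is the
  cofibrancy of \<open>c\<close>.\<close>

lemma cosimplicial_resolution_const_cosimp:
  assumes c: "cofib c" and e: "e \<in> Weq M" "e \<in> arrows C c x"
  shows "cosimplicial_resolution C M x (const_cosimp c) (\<lambda>_. e)"
proof -
  have cA: "c \<in> Obj C" using e arrow_obj by blast
  have id: "Id C c \<in> arrows C c c" using cA by (rule Id_in)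
  have idid: "Comp C (Id C c) (Id C c) = Id C c" using thin[OF Comp_in[OF id id] id] .
  have "cosimplicial_object C (const_cosimp c)"
    using cA id idid by (simp add: cosimplicial_object_def const_cosimp_def)
  moreover have "reedy_cofibrant C M (const_cosimp c)"
    unfolding reedy_cofibrant_def
  proof
    fix m
    show "\<exists>l d. latching_object C (const_cosimp c) m l d \<and>
        (\<exists>i\<in>Cof M. i \<in> arrows C l (cobj (const_cosimp c) m) \<and>
           (\<forall>k<m. \<forall>\<theta>\<in>delta_inj k m. Comp C i (d k \<theta>) = cmap (const_cosimp c) k m \<theta>))"
    proof (cases "m = 0")
      case True
      obtain b i where b: "\<forall>x\<in>Obj C. below b x" and i: "i \<in> Cof M" "i \<in> arrows C b c"
        using c by (auto simp: cofib_def hom_rel_def)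
      \<comment> \<open>The cocone has no legs at level 0, so any value will do.\<close>
      have "latching_object C (const_cosimp c) m b undefined"
        using True b arrow_obj[OF i(2)] thin
        unfolding latching_object_def latching_cocone_def below_iff by auto
      then show ?thesis using i True by (auto simp: const_cosimp_def)
    next
      case False
      have "latching_object C (const_cosimp c) m c (\<lambda>_ _. Id C c)"
        unfolding latching_object_def
      proof (intro conjI allI impI)
        show "latching_cocone C (const_cosimp c) m c (\<lambda>_ _. Id C c)"
          using cA id idid by (simp add: latching_cocone_def const_cosimp_def)
        fix l' c' assume l': "latching_cocone C (const_cosimp c) m l' c'"
        \<comment> \<open>A vertex of \<open>[m]\<close> makes the diagram nonempty and supplies an
          arrow \<open>c -> l'\<close>; thinness gives the rest.\<close>
        have "(\<lambda>i\<in>{..0}. 0) \<in> delta_inj 0 m" by (auto simp: delta_inj_def delta_def mono_on_def)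
        then have "c' 0 (\<lambda>i\<in>{..0}. 0) \<in> arrows C c l'"
          using l' False by (auto simp: latching_cocone_def const_cosimp_def)
        then obtain u where u: "u \<in> arrows C c l'" by blast
        have "Comp C u (Id C c) = c' k \<theta>" if "k < m" "\<theta> \<in> delta_inj k m" for k \<theta>
          using thin[OF Comp_in[OF id u]] l' that by (auto simp: latching_cocone_def const_cosimp_def)
        then show "\<exists>!u. u \<in> arrows C c l' \<and> (\<forall>k<m. \<forall>\<theta>\<in>delta_inj k m. Comp C u (Id C c) = c' k \<theta>)"
          using u thin by blast
      qed
      moreover have "Id C c \<in> Cof M"
        using left_right_refl[OF cof_sys cA] mem_iff_hom_rel[OF id] by blast
      ultimately show ?thesis using id idid by (auto simp: const_cosimp_def)
    qed
  qed
  moreover have "Comp C e (Id C c) = e" using thin[OF Comp_in[OF id e(2)] e(2)] .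
  ultimately show ?thesis using e by (simp add: cosimplicial_resolution_def const_cosimp_def)
qed

text \<open>Mapping spaces are empty or points, and \<open>hle\<close> decides which.\<close>

lemma precomp_weak_equiv_iff:
  assumes f: "f \<in> arrows C x y" and z: "z \<in> Obj C"
  shows "precomp_weak_equiv C M f z \<longleftrightarrow> (hle x z \<longleftrightarrow> hle y z)"
proof -
  interpret op: model_chain_cat "op_cat C" "op_model M" by (rule op_model_chain_cat)
  have dom: "Dom C f = x" "Cod C f = y" using f by (auto simp: arrows_def)
  \<comment> \<open>Proved for arbitrary resolutions: one direction receives unknown ones, the other
    supplies constant ones.\<close>
  have key: "sset_weak_equiv (map_space C Y Z) (map_space C X Z) (\<lambda>m h. Comp C h (\<phi> m)) \<longleftrightarrow>
      (hle x z \<longleftrightarrow> hle y z)"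
    if X: "cosimplicial_resolution C M x X eX" and Y: "cosimplicial_resolution C M y Y eY"
      and \<phi>: "cosimplicial_map C X Y \<phi>" and Z: "simplicial_resolution C M z Z eZ"
    for X eX Y eY \<phi> Z eZ
  proof -
    note objs = cosimplicial_resolution_object[OF X] cosimplicial_resolution_object[OF Y]
      cosimplicial_resolution_object[OF Z]
    have "fib (cobj Z 0)" "weq z (cobj Z 0)"
      using op.cosimplicial_resolution_cofib[OF Z] by (simp_all add: op_cofib)
    then have "below (cobj X 0) (cobj Z 0) \<longleftrightarrow> hle x z" "below (cobj Y 0) (cobj Z 0) \<longleftrightarrow> hle y z"
      using le_replacements_iff_hle cosimplicial_resolution_cofib[OF X]
        cosimplicial_resolution_cofib[OF Y] by blast+
    moreover have "Comp C h (\<phi> m) \<in> simplices (map_space C X Z) m"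
      if "h \<in> simplices (map_space C Y Z) m" for m h
      using that \<phi> unfolding map_space_def cosimplicial_map_def by (auto intro: Comp_in)
    ultimately show ?thesis
      using sset_weak_equiv_subterminal_iff[OF subterminal_map_space[OF objs(2,3)]
          subterminal_map_space[OF objs(1,3)], of "\<lambda>m h. Comp C h (\<phi> m)"]
      by (simp add: map_space_def below_iff) blast
  qed
  show ?thesis
  proof
    assume "precomp_weak_equiv C M f z"
    then show "hle x z \<longleftrightarrow> hle y z" unfolding precomp_weak_equiv_def dom using key by blast
  next
    assume r: "hle x z \<longleftrightarrow> hle y z"
    have xy: "x \<in> Obj C" "y \<in> Obj C" "below x y" using f arrow_obj below_iff by blast+
    obtain c where c: "cofib c" "weq c x" using ex_cofib[OF xy(1)] by blast
    obtain c' where c': "cofib c'" "weq c' y" "hom_rel C (Fib M) c' y" using ex_cofib[OF xy(2)] by blast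
    obtain d where d: "fib d" "weq z d" using ex_fib[OF z] by blast
    \<comment> \<open>The map of resolutions over \<open>f\<close> comes from lifting against
      \<open>c' -> y\<close>, which was chosen to be an acyclic fibration for this purpose.\<close>
    have "below c c'" using cofib_lift[OF c(1) c'(2,3)] weq_le[OF c(2)] xy(3) le_trans by blast
    then obtain u where u: "u \<in> arrows C c c'" using below_iff by blast
    obtain e e' e'' where e: "e \<in> Weq M" "e \<in> arrows C c x" "e' \<in> Weq M" "e' \<in> arrows C c' y"
      "e'' \<in> Weq M" "e'' \<in> arrows C z d"
      using c(2) c'(2) d(2) by (auto simp: hom_rel_def)
    have X: "cosimplicial_resolution C M x (const_cosimp c) (\<lambda>_. e)"
      using cosimplicial_resolution_const_cosimp c e by blast
    have Y: "cosimplicial_resolution C M y (const_cosimp c') (\<lambda>_. e')"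
      using cosimplicial_resolution_const_cosimp c' e by blast
    have Z: "simplicial_resolution C M z (op.const_cosimp d) (\<lambda>_. e'')"
      using op.cosimplicial_resolution_const_cosimp[of d e'' z] d e by (simp add: op_cofib)
    have "Comp C u (Id C c) = Comp C (Id C c') u"
      using thin Comp_in Id_in u arrow_obj by meson
    then have \<phi>: "cosimplicial_map C (const_cosimp c) (const_cosimp c') (\<lambda>_. u)"
      using u by (simp add: cosimplicial_map_def const_cosimp_def)
    have "Comp C e' u = Comp C f e" using thin Comp_in u e f by meson
    then show "precomp_weak_equiv C M f z"
      unfolding precomp_weak_equiv_def dom using X Y Z \<phi> key[OF X Y \<phi> Z] r by blast
  qed
qed

text \<open>The inverse of a localization: \<open>M'\<close> is the cut structure, and
  \<open>weq_iff_cut_local\<close> says that its local equivalences are the original weak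
  equivalences.\<close>

lemma left_localization_at_uncrossed_step:
  assumes f: "f \<in> Weq M" "f \<in> arrows C p q" and pq: "step p q"
    and nocross: "\<And>a b. weq a b \<Longrightarrow> hom_rel C (Fib M) a b \<Longrightarrow> \<not> (below a p \<and> below q b)"
  obtains M' where "model_structure C M'" "Weq M' \<subset> Weq M" "left_localization C M' {f} M"
proof -
  define M' where "M' = \<lparr>Weq = {g \<in> Arr C. cut_weq p q (Dom C g) (Cod C g)}, Cof = Cof M,
    Fib = {g \<in> Arr C. cut_fib p q (Dom C g) (Cod C g)}\<rparr>"
  have "below x y" if "cut_weq p q x y" for x y using that weq_le by (simp add: cut_weq_def)
  moreover have "below x y" if "cut_fib p q x y" for x y using that by (simp add: cut_fib_def)
  ultimately have rels: "hom_rel C (Weq M') = cut_weq p q" "hom_rel C (Fib M') = cut_fib p q"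
    "Cof M' = Cof M"
    by (simp_all add: M'_def hom_rel_Collect)
  have cut: "chain_model (Obj C) below (cut_weq p q) (hom_rel C (Cof M)) (cut_fib p q)"
    by (rule cut_model[OF pq nocross])
  have M': "model_structure C M'"
    using cut model unfolding model_structure_iff rels by (auto simp: M'_def)
  interpret c: model_chain_cat C M' by unfold_locales (rule M')
  have pqW: "weq p q" using f by (rule hom_relI)
  have "local_obj C M' {f} z \<longleftrightarrow> c.fib z \<and> (c.hle p z \<longleftrightarrow> c.hle q z)" for z
  proof -
    have "z \<in> Obj C" if "c.fib z"
      using that unfolding c.fibrant_iff[symmetric] fibrant_def by blast
    then show ?thesis
      using c.precomp_weak_equiv_iff[OF f(2)] by (auto simp: local_obj_def c.fibrant_iff)
  qed
  then have loc: "local_equivs C M' {f} = {g \<in> Arr C. \<forall>z. c.fib z \<and> (c.hle p z \<longleftrightarrow> c.hle q z) \<longrightarrow>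
      (c.hle (Dom C g) z \<longleftrightarrow> c.hle (Cod C g) z)}"
    using c.precomp_weak_equiv_iff[OF in_arrows] c.fibrant_iff
    unfolding local_equivs_def fibrant_def by blast
  have "g \<in> Weq M \<longleftrightarrow> g \<in> local_equivs C M' {f}" for g
  proof (cases "g \<in> Arr C")
    case True
    then have arr: "g \<in> arrows C (Dom C g) (Cod C g)" by (rule in_arrows)
    then have "g \<in> Weq M \<longleftrightarrow> weq (Dom C g) (Cod C g)" by (rule mem_iff_hom_rel)
    also have "\<dots> \<longleftrightarrow> g \<in> local_equivs C M' {f}"
      unfolding weq_iff_cut_local[OF pq pqW cut, folded rels(1,2)] loc
      using True arr below_iff by blast
    finally show ?thesis .
  next
    case False
    then show ?thesis using model unfolding loc model_structure_iff by auto
  qed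
  then have "left_localization C M' {f} M"
    using model by (auto simp: left_localization_def rels)
  moreover have "Weq M' \<subseteq> Weq M"
    using mem_iff_hom_rel[OF in_arrows] by (auto simp: M'_def cut_weq_def)
  \<comment> \<open>The localized arrow itself crosses the step, so the inclusion is strict.\<close>
  moreover have "f \<notin> Weq M'"
    using mem_iff_hom_rel[OF f(2), of "Weq M'"] pq le_refl arrow_obj[OF f(2)]
    by (auto simp: rels cut_weq_def)
  ultimately show ?thesis using that M' f(1) by blast
qed

text \<open>The left case in the opposite category, where \<open>f\<close> is the step from
  \<open>q\<close> to \<open>p\<close> and cofibrations become fibrations.\<close>

lemma right_localization_at_uncrossed_step:
  assumes f: "f \<in> Weq M" "f \<in> arrows C p q" and pq: "step p q"
    and nocross: "\<And>a b. weq a b \<Longrightarrow> hom_rel C (Cof M) a b \<Longrightarrow> \<not> (below a p \<and> below q b)"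
  obtains M' where "model_structure C M'" "Weq M' \<subset> Weq M" "right_localization C M' {f} M"
proof -
  interpret op: model_chain_cat "op_cat C" "op_model M" by (rule op_model_chain_cat)
  have op_nocross: "\<not> (op.below a q \<and> op.below p b)"
    if "op.weq a b" "hom_rel (op_cat C) (Fib (op_model M)) a b" for a b
    using nocross[of b a] that by auto
  have "f \<in> Weq (op_model M)" "f \<in> arrows (op_cat C) q p" "op.step q p"
    using f pq by (simp_all add: step_converse)
  then obtain M' where M': "model_structure (op_cat C) M'" "Weq M' \<subset> Weq M"
    "left_localization (op_cat C) M' {f} (op_model M)"
    using op.left_localization_at_uncrossed_step[OF _ _ _ op_nocross] op_model_simps(1) by metis
  show ?thesis
  proof (rule that)
    show "model_structure C (op_model M')" using op.model_structure_op[OF M'(1)] by simp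
    show "Weq (op_model M') \<subset> Weq M" using M'(2) by simp
    show "right_localization C (op_model M') {f} M"
      by (rule right_localization_op) (simp add: M'(3))
  qed
qed

text \<open>In each of the two factorizations the acyclic factor is an identity, so every map equals
  the other factor.\<close>

lemma trivial_if_weq_trivial:
  assumes "\<And>x y. weq x y \<Longrightarrow> x = y"
  shows "M = trivial_model C"
proof -
  have iso: "isomorphism C f \<longleftrightarrow> f \<in> Weq M" for f
  proof
    assume "isomorphism C f"
    then have f: "f \<in> Arr C" and "Dom C f = Cod C f"
      using skeletal[OF in_arrows] unfolding isomorphism_def by blast+
    then show "f \<in> Weq M"
      using weq_refl mem_iff_hom_rel[OF in_arrows[OF f]] arrow_obj[OF in_arrows[OF f]] by simp
  next
    assume f: "f \<in> Weq M"
    then have fA: "f \<in> Arr C" using model by (auto simp: model_structure_iff)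
    then have eq: "Dom C f = Cod C f" using f assms hom_relI in_arrows by blast
    then have "f \<in> arrows C (Cod C f) (Cod C f)" using in_arrows[OF fA] by simp
    moreover from this have "Comp C f f = Id C (Cod C f)" using thin Comp_in Id_in arrow_obj by meson
    ultimately show "isomorphism C f" using fA eq by (auto simp: isomorphism_def)
  qed
  have "f \<in> Cof M" "f \<in> Fib M" if "f \<in> Arr C" for f
  proof -
    have "below (Dom C f) (Cod C f)" using in_arrows[OF that] below_iff by blast
    then have "hom_rel C (Cof M) (Dom C f) (Cod C f)" "hom_rel C (Fib M) (Dom C f) (Cod C f)"
      using factor[OF cof_sys] factor[OF fib_sys] assms by fastforce+
    then show "f \<in> Cof M" "f \<in> Fib M" using mem_iff_hom_rel[OF in_arrows[OF that]] by blast+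
  qed
  then have "Cof M = Arr C" "Fib M = Arr C" using model by (auto simp: model_structure_iff)
  then show ?thesis using iso by (auto simp: trivial_model_def)
qed

end

section \<open>The category \<open>[n]\<close> and descent to the trivial structure\<close>

lemma chain_cat_ordinal_cat: "chain_cat (ordinal_cat n)"
  by unfold_locales (use category_ordinal_cat in \<open>auto simp: ordinal_cat_def arrows_def\<close>)

lemma step_ordinal_cat:
  assumes "finite_chain.step (Obj (ordinal_cat n)) (hom_rel (ordinal_cat n) (Arr (ordinal_cat n))) p q"
  shows "p < n \<and> q = p + 1"
proof -
  interpret chain_cat "ordinal_cat n" by (rule chain_cat_ordinal_cat)
  have "arrows (ordinal_cat n) x y = (if x \<le> y \<and> y \<le> n then {(x, y)} else {})" for x y
    by (auto simp: arrows_def ordinal_cat_def)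
  then have below: "below x y \<longleftrightarrow> x \<le> y \<and> y \<le> n" for x y by (simp add: below_iff)
  have "p < q" "q \<le> n" using assms by (auto simp: step_def below)
  \<comment> \<open>Testing the covering condition at \<open>p + 1\<close>, which is not below
    \<open>p\<close>, bounds \<open>q\<close>.\<close>
  moreover from this have "p + 1 \<in> Obj (ordinal_cat n)" by (simp add: ordinal_cat_def)
  then have "q \<le> p + 1" using assms by (fastforce simp: step_def below)
  ultimately show ?thesis by simp
qed

theorem theorem5p12:
  fixes n :: nat and M :: "(nat \<times> nat) model_str"
  assumes "model_structure (ordinal_cat n) M"
  shows "obtainable n M"
  using assms
proof (induction "card (Weq M)" arbitrary: M rule: less_induct)
  case less
  let ?C = "ordinal_cat n"
  interpret chain_cat ?C by (rule chain_cat_ordinal_cat)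
  interpret model_chain_cat ?C M by unfold_locales (rule less.prems)
  have "Arr ?C \<subseteq> {0..n} \<times> {0..n}" by (auto simp: ordinal_cat_def)
  then have "finite (Arr ?C)" by (rule finite_subset) simp
  moreover have "Weq M \<subseteq> Arr ?C" using less.prems model_structure_iff by blast
  ultimately have "finite (Weq M)" by (rule rev_finite_subset)
  \<comment> \<open>Each descent produces an \<open>M'\<close> with fewer weak equivalences whose
    localization is \<open>M\<close>, so obtainability passes from \<open>M'\<close> to
    \<open>M\<close>.\<close>
  then have IH: "obtainable n M'" if "model_structure ?C M'" "Weq M' \<subset> Weq M" for M'
    using less.hyps that psubset_card_mono by blast
  have arr: "(p, p + 1) \<in> Weq M \<and> (p, p + 1) \<in> arrows ?C p (p + 1)" if w: "weq p (p + 1)" for p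
  proof -
    obtain f where "f \<in> Weq M" "f \<in> arrows ?C p (p + 1)" using w unfolding hom_rel_def by blast
    moreover from this have "f = (p, p + 1)" by (simp add: arrows_def ordinal_cat_def prod_eq_iff)
    ultimately show ?thesis by simp
  qed
  show ?case
  proof (cases "\<exists>x y. weq x y \<and> x \<noteq> y")
    case False
    then show ?thesis using trivial_if_weq_trivial obtainable.trivial by metis
  next
    case True
    then obtain x y where "weq x y" "x \<noteq> y" by blast
    then show ?thesis
    proof (cases rule: ex_uncrossed_step)
      case (fib p q)
      then have pq: "p < n" "q = p + 1" using step_ordinal_cat by blast+
      then obtain M' where "model_structure ?C M'" "Weq M' \<subset> Weq M"
        "left_localization ?C M' {(p, p + 1)} M"
        using left_localization_at_uncrossed_step[of "(p, p + 1)" p q] arr fib by metis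
      then show ?thesis using IH obtainable.left pq by blast
    next
      case (cof p q)
      then have pq: "p < n" "q = p + 1" using step_ordinal_cat by blast+
      then obtain M' where "model_structure ?C M'" "Weq M' \<subset> Weq M"
        "right_localization ?C M' {(p, p + 1)} M"
        using right_localization_at_uncrossed_step[of "(p, p + 1)" p q] arr cof by metis
      then show ?thesis using IH obtainable.right pq by blast
    qed
  qed
qed

end
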